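(* Let $G$ be an $n$-vertex $m$-edge Helly graph and let $k$ be a parameter such that $rad(G) > 3k$ and $3k=\omega(\log n)$. Then there is a randomized algorithm which, w.h.p., computes a diametral pair of $G$ in $\tilde{\mathcal O}(mn/k)$ time.
   Context: Graphs are finite, connected, undirected and unweighted, with shortest-path distance $dist$. A graph is Helly if every family of pairwise intersecting balls $N^r[v]=\{u: dist(u,v)\le r\}$ has a nonempty common intersection. $e(u)=\max_v dist(u,v)$, $rad(G)=\min_u e(u)$, $diam(G)=\max_u e(u)$. A diametral pair is a pair $(x,y)$ with $dist(x,y)=diam(G)$. "W.h.p." means with probability at least $1-n^{-c}$ for an arbitrarily large constant $c$; $\tilde{\mathcal O}$ hides polylogarithmic factors. *)

theory Defs
  imports "HOL-Probability.Probability" "HOL-Library.Landau_Symbols" "HOL-Library.Log_Nat"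
begin

section \<open>Graphs\<close>

definition simple_graph :: "'a set \<Rightarrow> 'a set set \<Rightarrow> bool" where
  "simple_graph V E \<longleftrightarrow> finite V \<and> V \<noteq> {} \<and> (\<forall>e\<in>E. e \<subseteq> V \<and> card e = 2)"

definition adjacency :: "'a set set \<Rightarrow> 'a rel" where
  "adjacency E = {(u, v). {u, v} \<in> E}"

definition connected_graph :: "'a set \<Rightarrow> 'a set set \<Rightarrow> bool" where
  "connected_graph V E \<longleftrightarrow> (\<forall>u\<in>V. \<forall>v\<in>V. (u, v) \<in> (adjacency E)\<^sup>*)"

text \<open>Length of a shortest walk; a junk value if there is none.\<close>
definition gdist :: "'a set set \<Rightarrow> 'a \<Rightarrow> 'a \<Rightarrow> nat" where
  "gdist E u v = (LEAST l. (u, v) \<in> adjacency E ^^ l)"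

definition gball :: "'a set \<Rightarrow> 'a set set \<Rightarrow> 'a \<Rightarrow> nat \<Rightarrow> 'a set" where
  "gball V E v r = {u \<in> V. gdist E u v \<le> r}"

definition helly_graph :: "'a set \<Rightarrow> 'a set set \<Rightarrow> bool" where
  "helly_graph V E \<longleftrightarrow>
     simple_graph V E \<and> connected_graph V E \<and>
     (\<forall>F \<subseteq> V \<times> UNIV.
        (\<forall>(u, r)\<in>F. \<forall>(v, s)\<in>F. gball V E u r \<inter> gball V E v s \<noteq> {}) \<longrightarrow>
        (\<exists>x\<in>V. \<forall>(v, r)\<in>F. x \<in> gball V E v r))"

definition ecc :: "'a set \<Rightarrow> 'a set set \<Rightarrow> 'a \<Rightarrow> nat" where
  "ecc V E u = Max (gdist E u ` V)"

definition rad :: "'a set \<Rightarrow> 'a set set \<Rightarrow> nat" where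
  "rad V E = Min (ecc V E ` V)"

definition diam :: "'a set \<Rightarrow> 'a set set \<Rightarrow> nat" where
  "diam V E = Max (ecc V E ` V)"

definition diametral_pair :: "'a set \<Rightarrow> 'a set set \<Rightarrow> 'a \<Rightarrow> 'a \<Rightarrow> bool" where
  "diametral_pair V E x y \<longleftrightarrow> x \<in> V \<and> y \<in> V \<and> gdist E x y = diam V E"


section \<open>Randomized algorithms\<close>

text \<open>
  Algorithms are programs of a probabilistic random access machine: a structured language over
  natural-number variables and arrays, with a fair coin as the only source of randomness.
  Running time is the logarithmic cost: every value that is read or computed is
  charged its length in binary. This agrees with the unit-cost word RAM with words
  of \<open>O(log n)\<close> bits up to polylogarithmic factors, and it rules out cheap arithmetic on huge
  numbers.
\<close>

type_synonym vname = string

datatype exp =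
    Const nat
  | Var vname
  | Read vname exp
  | Add exp exp
  | Sub exp exp
  | Mul exp exp
  | Div exp exp

datatype com =
    Skip
  | Assign vname exp
  | Store vname exp exp
  | Flip vname
  | Seq com com
  | Cond exp com com
  | While exp com

record store =
  var :: "vname \<Rightarrow> nat"
  arr :: "vname \<Rightarrow> nat \<Rightarrow> nat"

text \<open>\<open>Sub\<close> is truncated subtraction, so \<open>Sub b a\<close> is nonzero iff \<open>a < b\<close>; tests succeed on
  nonzero values.\<close>
primrec eval :: "store \<Rightarrow> exp \<Rightarrow> nat" where
  "eval s (Const i) = i"
| "eval s (Var x) = var s x"
| "eval s (Read a e) = arr s a (eval s e)"
| "eval s (Add e f) = eval s e + eval s f"
| "eval s (Sub e f) = eval s e - eval s f"
| "eval s (Mul e f) = eval s e * eval s f"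
| "eval s (Div e f) = eval s e div eval s f"

definition value_cost :: "nat \<Rightarrow> nat" where
  "value_cost i = Suc (floorlog 2 i)"

primrec eval_cost :: "store \<Rightarrow> exp \<Rightarrow> nat" where
  "eval_cost s (Const i) = value_cost i"
| "eval_cost s (Var x) = value_cost (var s x)"
| "eval_cost s (Read a e) = eval_cost s e + value_cost (eval s (Read a e))"
| "eval_cost s (Add e f) = eval_cost s e + eval_cost s f + value_cost (eval s (Add e f))"
| "eval_cost s (Sub e f) = eval_cost s e + eval_cost s f + value_cost (eval s (Sub e f))"
| "eval_cost s (Mul e f) = eval_cost s e + eval_cost s f + value_cost (eval s (Mul e f))"
| "eval_cost s (Div e f) = eval_cost s e + eval_cost s f + value_cost (eval s (Div e f))"

definition set_var :: "vname \<Rightarrow> nat \<Rightarrow> store \<Rightarrow> store" where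
  "set_var x i s = s\<lparr>var := (var s)(x := i)\<rparr>"

definition set_arr :: "vname \<Rightarrow> nat \<Rightarrow> nat \<Rightarrow> store \<Rightarrow> store" where
  "set_arr a j i s = s\<lparr>arr := (arr s)(a := (arr s a)(j := i))\<rparr>"

text \<open>A configuration consists of the stack of commands still to be executed, the store, and the
  time spent so far. The machine has halted when the stack is empty.\<close>
type_synonym config = "com list \<times> store \<times> nat"

fun step :: "config \<Rightarrow> config pmf" where
  "step ([], s, t) = return_pmf ([], s, t)"
| "step (Skip # cs, s, t) = return_pmf (cs, s, t + 1)"
| "step (Assign x e # cs, s, t) =
     return_pmf (cs, set_var x (eval s e) s, t + 1 + eval_cost s e)"
| "step (Store a e f # cs, s, t) =
     return_pmf (cs, set_arr a (eval s e) (eval s f) s, t + 1 + eval_cost s e + eval_cost s f)"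
| "step (Flip x # cs, s, t) =
     map_pmf (\<lambda>b. (cs, set_var x (if b then 1 else 0) s, t + 1)) (bernoulli_pmf (1/2))"
| "step (Seq c d # cs, s, t) = return_pmf (c # d # cs, s, t + 1)"
| "step (Cond e c d # cs, s, t) =
     return_pmf ((if eval s e \<noteq> 0 then c else d) # cs, s, t + 1 + eval_cost s e)"
| "step (While e c # cs, s, t) =
     return_pmf (if eval s e \<noteq> 0 then c # While e c # cs else cs, s, t + 1 + eval_cost s e)"

definition run :: "nat \<Rightarrow> com \<Rightarrow> store \<Rightarrow> config pmf" where
  "run N P s = ((\<lambda>p. bind_pmf p step) ^^ N) (return_pmf ([P], s, 0))"

text \<open>Probability that \<open>P\<close>, started in \<open>s\<close>, halts within time \<open>T\<close> in a store satisfying \<open>Q\<close>.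
  Every step takes time at least 1, so only the first \<open>T\<close> steps matter.\<close>
definition success_prob :: "com \<Rightarrow> store \<Rightarrow> nat \<Rightarrow> (store \<Rightarrow> bool) \<Rightarrow> real" where
  "success_prob P s T Q =
     measure_pmf.prob (run T P s) {(cs, s', t). cs = [] \<and> t \<le> T \<and> Q s'}"


section \<open>Input encoding\<close>

definition adj_lists :: "nat \<Rightarrow> nat set set \<Rightarrow> (nat \<Rightarrow> nat list) \<Rightarrow> bool" where
  "adj_lists n E L \<longleftrightarrow> (\<forall>v<n. distinct (L v) \<and> set (L v) = {u. {v, u} \<in> E})"

definition array_of :: "nat list \<Rightarrow> nat \<Rightarrow> nat" where
  "array_of xs i = (if i < length xs then xs ! i else 0)"

text \<open>The adjacency lists of the vertices \<open>0, \<dots>, n - 1\<close> are stored consecutively in \<open>nbr\<close>; the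
  list of \<open>v\<close> occupies the positions from \<open>off[v]\<close> up to but excluding \<open>off[v + 1]\<close>.\<close>
definition graph_input :: "nat \<Rightarrow> nat \<Rightarrow> (nat \<Rightarrow> nat list) \<Rightarrow> nat \<Rightarrow> store" where
  "graph_input n m L k =
     \<lparr>var = (\<lambda>_. 0)(''n'' := n, ''m'' := m, ''k'' := k),
      arr = (\<lambda>_ _. 0)(''off'' := array_of (map (\<lambda>v. \<Sum>u<v. length (L u)) [0..<Suc n]),
                      ''nbr'' := array_of (concat (map L [0..<n])))\<rparr>"

end

theory Submission imports Defs begin

text \<open>
  The algorithm is deterministic. Fix a root \<open>c\<close>, choose the smallest class of vertices whose
  distances to \<open>c\<close> agree modulo \<open>k\<close>, and let \<open>U\<close> consist of \<open>c\<close> and this class. A breadth-first search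
  from each of the at most \<open>1 + n/k\<close> vertices of \<open>U\<close> yields the upper bounds
  \<open>f(v) = min {e(u) + dist(u, v) | u \<in> U}\<close> on the eccentricities \<open>e(v)\<close>.

  The Helly property applied to the balls of radius \<open>rad\<close> around all vertices, a ball of radius
  \<open>e(v) - rad\<close> around \<open>v\<close> and a ball around \<open>c\<close> provides a central vertex \<open>w\<close> with
  \<open>e(v) = dist(v, w) + rad\<close> whose distance to \<open>c\<close> is as small as these balls permit. If the
  distances of \<open>v\<close> and \<open>w\<close> to \<open>c\<close> differ by at least \<open>k - 1\<close>, every path from \<open>v\<close> to \<open>w\<close> meets \<open>U\<close>,
  hence \<open>f(v) = e(v)\<close>. Otherwise, provided \<open>e(c) \<le> rad + k\<close>, one gets \<open>f(v) < rad + 3k\<close>, which is less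
  than \<open>2 rad - 1 \<le> diam\<close>. So a vertex maximising \<open>f\<close> has eccentricity \<open>diam\<close>. A suitable \<open>c\<close> comes
  from a first round with an arbitrary root: \<open>U\<close> is within distance \<open>k - 1\<close> of every vertex, so that
  some vertex of \<open>U\<close> has eccentricity less than \<open>rad + k\<close>.
\<close>

section \<open>Distances in connected graphs\<close>

lemma adjacency_sym: "(u, v) \<in> adjacency E \<longleftrightarrow> (v, u) \<in> adjacency E"
  by (simp add: adjacency_def insert_commute)

lemma relpow_adjacency_sym: "(u, v) \<in> adjacency E ^^ l \<Longrightarrow> (v, u) \<in> adjacency E ^^ l"
proof (induction l arbitrary: v)
  case (Suc l)
  then obtain w where "(u, w) \<in> adjacency E ^^ l" "(w, v) \<in> adjacency E"
    by auto
  then show ?case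
    using Suc.IH relpow_Suc_I2 adjacency_sym by metis
qed simp

lemma residue_in_interval:
  fixes a k g :: nat
  assumes "g < k"
  obtains l where "a \<le> l" "l < a + k" "l mod k = g"
proof
  \<comment> \<open>Adding \<open>k\<close> before the truncated subtraction keeps the difference
    from being cut off at 0; the outer \<open>mod k\<close> brings the shift below
    \<open>k\<close>.\<close>
  define i where "i = (g + k - a mod k) mod k"
  have k: "0 < k"
    using assms by simp
  show "a \<le> a + i" "a + i < a + k"
    using k by (auto simp: i_def)
  have "(a + i) mod k = (a mod k + (g + k - a mod k)) mod k"
    unfolding i_def by (simp add: mod_simps)
  also have "\<dots> = (g + k) mod k"
    using mod_less_divisor[OF k, of a] by simp
  also have "\<dots> = g"
    using assms by simp
  finally show "(a + i) mod k = g" .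
qed

locale conn_graph =
  fixes V :: "'a set" and E :: "'a set set"
  assumes simple: "simple_graph V E" and conn: "connected_graph V E"
begin

lemma finite_V: "finite V" and V_nonempty: "V \<noteq> {}"
  using simple by (auto simp: simple_graph_def)

lemma edge_in_V: "(u, v) \<in> adjacency E \<Longrightarrow> u \<in> V \<and> v \<in> V"
  using simple by (auto simp: simple_graph_def adjacency_def)

lemma gdist_le: "(u, v) \<in> adjacency E ^^ l \<Longrightarrow> gdist E u v \<le> l"
  unfolding gdist_def by (rule Least_le)

lemma gdist_walk: "u \<in> V \<Longrightarrow> v \<in> V \<Longrightarrow> (u, v) \<in> adjacency E ^^ gdist E u v"
  unfolding gdist_def
  using conn rtrancl_imp_relpow LeastI_ex[of "\<lambda>l. (u, v) \<in> adjacency E ^^ l"]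
  by (metis connected_graph_def)

lemma gdist_sym: "gdist E u v = gdist E v u"
  unfolding gdist_def by (metis relpow_adjacency_sym)

lemma gdist_self [simp]: "gdist E u u = 0"
  using gdist_le[of u u 0] by simp

lemma gdist_eq_0: "u \<in> V \<Longrightarrow> v \<in> V \<Longrightarrow> gdist E u v = 0 \<longleftrightarrow> u = v"
  using gdist_walk[of u v] by auto

lemma gdist_triangle:
  assumes "u \<in> V" "v \<in> V" "w \<in> V"
  shows "gdist E u w \<le> gdist E u v + gdist E v w"
  using assms gdist_walk[of u v] gdist_walk[of v w]
  by (intro gdist_le) (auto simp: relpow_add)

lemma gdist_edge: "(u, v) \<in> adjacency E \<Longrightarrow> gdist E u v \<le> 1"
  by (intro gdist_le) simp

lemma gdist_edge_le:
  assumes "u \<in> V" "(v, w) \<in> adjacency E"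
  shows "gdist E u w \<le> Suc (gdist E u v)"
  using gdist_triangle[of u v w] gdist_edge[of v w] edge_in_V[of v w] assms by force

lemma gdist_SucE:
  assumes "u \<in> V" "v \<in> V" "gdist E u v = Suc l"
  obtains w where "(u, w) \<in> adjacency E" "w \<in> V" "gdist E w v = l"
proof -
  obtain w where w: "(u, w) \<in> adjacency E" "(w, v) \<in> adjacency E ^^ l"
    using gdist_walk[OF assms(1,2)] assms(3) relpow_Suc_D2 by metis
  have "w \<in> V"
    using w edge_in_V by blast
  moreover have "gdist E w v = l"
    using gdist_le[OF w(2)] gdist_edge[OF w(1)] gdist_triangle[of u w v] assms \<open>w \<in> V\<close> by simp
  ultimately show ?thesis
    using that w by blast
qed

text \<open>A discrete intermediate value argument: along an edge the distance to \<open>c\<close>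
  changes by at most one, so a shortest path from \<open>v\<close> to \<open>w\<close> cannot skip
  the level \<open>l\<close>. The induction walks from \<open>v\<close> along the path until that
  level is met.\<close>

lemma geodesic_level:
  assumes "c \<in> V" "v \<in> V" "w \<in> V" "gdist E c w \<le> l" "l \<le> gdist E c v"
  obtains u where "u \<in> V" "gdist E v u + gdist E u w = gdist E v w" "gdist E c u = l"
proof -
  have "\<exists>u\<in>V. gdist E v u + gdist E u w = gdist E v w \<and> gdist E c u = l"
    using assms(2,5)
  proof (induction "gdist E v w" arbitrary: v)
    case 0
    then show ?case
      using assms gdist_eq_0[of v w] by force
  next
    case (Suc d)
    show ?case
    proof (cases "gdist E c v = l")
      case True
      then show ?thesis
        using Suc.prems by force
    next
      case False
      obtain v' where v': "(v, v') \<in> adjacency E" "v' \<in> V" "gdist E v' w = d"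
        using gdist_SucE[of v w d] Suc assms by metis
      have "gdist E c v \<le> Suc (gdist E c v')"
        using gdist_edge_le[of c v' v] v' assms adjacency_sym by metis
      then obtain u where u: "u \<in> V" "gdist E v' u + gdist E u w = gdist E v' w" "gdist E c u = l"
        using Suc.hyps(1)[of v'] v' False Suc.prems by force
      have "gdist E v u \<le> Suc (gdist E v' u)"
        using gdist_triangle[of v v' u] gdist_edge[OF v'(1)] v' u Suc.prems by force
      moreover have "gdist E v w \<le> gdist E v u + gdist E u w"
        using gdist_triangle u Suc.prems assms by blast
      ultimately show ?thesis
        using u v' Suc.hyps(2) by force
    qed
  qed
  then show ?thesis
    using that by blast
qed

text \<open>Every level from 0 up to the distance is occupied, which requires one vertex more than
  the distance.\<close>

lemma gdist_less_card:
  assumes "u \<in> V" "v \<in> V"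
  shows "gdist E u v < card V"
proof -
  have "{..gdist E u v} \<subseteq> gdist E u ` V"
  proof
    fix l assume "l \<in> {..gdist E u v}"
    then obtain w where "w \<in> V" "gdist E u w = l"
      using geodesic_level[of u v u l] assms by auto
    then show "l \<in> gdist E u ` V"
      by blast
  qed
  then have "card {..gdist E u v} \<le> card (gdist E u ` V)"
    using finite_V by (intro card_mono) auto
  also have "\<dots> \<le> card V"
    using finite_V by (rule card_image_le)
  finally show ?thesis
    by simp
qed

section \<open>Eccentricity, radius and diameter\<close>

lemma gdist_le_ecc: "v \<in> V \<Longrightarrow> gdist E u v \<le> ecc V E u"
  unfolding ecc_def using finite_V by simp

lemma ecc_attained:
  obtains v where "v \<in> V" "ecc V E u = gdist E u v"
proof -
  have "ecc V E u \<in> gdist E u ` V"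
    unfolding ecc_def using finite_V V_nonempty by (intro Max_in) auto
  then show ?thesis
    using that by blast
qed

lemma ecc_leI: "(\<And>v. v \<in> V \<Longrightarrow> gdist E u v \<le> b) \<Longrightarrow> ecc V E u \<le> b"
  using ecc_attained by metis

lemma ecc_less_card: "u \<in> V \<Longrightarrow> ecc V E u < card V"
  using ecc_attained gdist_less_card by metis

lemma ecc_le_add_gdist:
  assumes "u \<in> V" "v \<in> V"
  shows "ecc V E u \<le> gdist E u v + ecc V E v"
proof (rule ecc_leI)
  fix w assume "w \<in> V"
  then show "gdist E u w \<le> gdist E u v + ecc V E v"
    using gdist_triangle[of u v w] gdist_le_ecc[of w v] assms by force
qed

lemma rad_le_ecc: "v \<in> V \<Longrightarrow> rad V E \<le> ecc V E v"
  unfolding rad_def using finite_V by simp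

lemma rad_attained:
  obtains c where "c \<in> V" "ecc V E c = rad V E"
proof -
  have "rad V E \<in> ecc V E ` V"
    unfolding rad_def using finite_V V_nonempty by (intro Min_in) auto
  then show ?thesis
    using that by (metis imageE)
qed

lemma rad_less_card: "rad V E < card V"
  using rad_attained ecc_less_card by metis

lemma ecc_le_diam: "v \<in> V \<Longrightarrow> ecc V E v \<le> diam V E"
  unfolding diam_def using finite_V by simp

lemma diam_attained:
  obtains v where "v \<in> V" "ecc V E v = diam V E"
proof -
  have "diam V E \<in> ecc V E ` V"
    unfolding diam_def using finite_V V_nonempty by (intro Max_in) auto
  then show ?thesis
    using that by (metis imageE)
qed

text \<open>The vertex of a shortest path at distance exactly \<open>r\<close> from \<open>u\<close>
  lies in both balls, unless \<open>v\<close> itself does. This reduces the Helly condition to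
  inequalities between distances.\<close>

lemma balls_intersect:
  assumes "u \<in> V" "v \<in> V" "gdist E u v \<le> r + s"
  shows "gball V E u r \<inter> gball V E v s \<noteq> {}"
proof (cases "gdist E u v \<le> r")
  case True
  then have "v \<in> gball V E u r \<inter> gball V E v s"
    using assms gdist_sym[of u v] by (simp add: gball_def)
  then show ?thesis
    by blast
next
  case False
  then obtain w where "w \<in> V" "gdist E v w + gdist E w u = gdist E v u" "gdist E u w = r"
    using geodesic_level[of u v u r] assms by auto
  then have "w \<in> gball V E u r \<inter> gball V E v s"
    using assms gdist_sym[of u v] gdist_sym[of u w] gdist_sym[of v w] by (simp add: gball_def)
  then show ?thesis
    by blast
qed

text \<open>The root is added because a vertex at distance less than \<open>k - 1\<close> from
  \<open>c\<close> may have no vertex of residue \<open>g\<close> on its shortest paths to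
  \<open>c\<close>.\<close>

definition hitting_set :: "nat \<Rightarrow> 'a \<Rightarrow> nat \<Rightarrow> 'a set" where
  "hitting_set k c g = insert c {u \<in> V. gdist E c u mod k = g}"

text \<open>The last premise leaves at least \<open>k\<close> levels from that of \<open>w\<close>
  to that of \<open>v\<close>, both included. One of them has residue \<open>g\<close>, and the
  shortest path crosses it.\<close>

lemma geodesic_hits:
  assumes "c \<in> V" "v \<in> V" "w \<in> V" "g < k" "gdist E c w + k \<le> Suc (gdist E c v)"
  obtains u where "u \<in> V" "u \<in> hitting_set k c g" "gdist E v u + gdist E u w = gdist E v w"
proof -
  obtain l where l: "gdist E c w \<le> l" "l < gdist E c w + k" "l mod k = g"
    using residue_in_interval assms(4) by metis
  have "l \<le> gdist E c v"
    using l assms by linarith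
  then obtain u where "u \<in> V" "gdist E v u + gdist E u w = gdist E v w" "gdist E c u = l"
    using geodesic_level[OF assms(1-3) l(1)] by metis
  then show ?thesis
    using that l by (auto simp: hitting_set_def)
qed

text \<open>Walking \<open>k - 1\<close> steps from \<open>v\<close> towards \<open>c\<close>
  crosses \<open>k\<close> levels, one of them of residue \<open>g\<close>. A vertex within distance
  \<open>k - 1\<close> of the root is served by \<open>c\<close> itself.\<close>

lemma hitting_set_dominates:
  assumes "c \<in> V" "v \<in> V" "g < k"
  obtains u where "u \<in> V" "u \<in> hitting_set k c g" "gdist E v u < k"
proof (cases "Suc (gdist E c v) \<le> k")
  case True
  then have "gdist E v c < k"
    using gdist_sym[of c v] by simp
  then show ?thesis
    using that[of c] assms by (simp add: hitting_set_def)
next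
  case False
  have "gdist E c c \<le> Suc (gdist E c v) - k" "Suc (gdist E c v) - k \<le> gdist E c v"
    using assms by auto
  then obtain w where w: "w \<in> V" "gdist E v w + gdist E w c = gdist E v c"
    "gdist E c w = Suc (gdist E c v) - k"
    using geodesic_level assms by metis
  have "gdist E c w + k \<le> Suc (gdist E c v)"
    using w False by simp
  then obtain u where u: "u \<in> V" "u \<in> hitting_set k c g"
    "gdist E v u + gdist E u w = gdist E v w"
    using geodesic_hits[OF assms(1,2) w(1) assms(3)] by metis
  show ?thesis
    using that[of u] u w False gdist_sym[of v c] gdist_sym[of w c] by auto
qed

end

section \<open>Eccentricities in Helly graphs\<close>

locale helly =
  fixes V :: "'a set" and E :: "'a set set"
  assumes helly: "helly_graph V E"

sublocale helly \<subseteq> conn_graph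
  using helly by unfold_locales (auto simp: helly_graph_def)

context helly
begin

lemma helly_balls:
  assumes "F \<subseteq> V \<times> UNIV"
    and "\<And>u r v s. (u, r) \<in> F \<Longrightarrow> (v, s) \<in> F \<Longrightarrow> gdist E u v \<le> r + s"
  shows "\<exists>x\<in>V. \<forall>(v, r)\<in>F. gdist E v x \<le> r"
proof -
  have "\<forall>(u, r)\<in>F. \<forall>(v, s)\<in>F. gball V E u r \<inter> gball V E v s \<noteq> {}"
    using assms balls_intersect by blast
  then obtain x where "x \<in> V" "\<forall>(v, r)\<in>F. x \<in> gball V E v r"
    using helly assms(1) unfolding helly_graph_def by blast
  then show ?thesis
    using gdist_sym by (fastforce simp: gball_def)
qed

text \<open>If the diameter were at most \<open>2 * rad - 2\<close>, the balls of radius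
  \<open>rad - 1\<close> around all vertices would meet pairwise, and a common vertex would have
  eccentricity below the radius.\<close>

lemma two_rad_le_diam: "2 * rad V E \<le> diam V E + 1"
proof (rule ccontr)
  assume "\<not> ?thesis"
  then have less: "diam V E + 2 \<le> 2 * rad V E"
    by simp
  have "gdist E u v \<le> (rad V E - 1) + (rad V E - 1)" if "u \<in> V" "v \<in> V" for u v
    using that gdist_le_ecc[of v u] ecc_le_diam[of u] less by linarith
  then have "\<exists>x\<in>V. \<forall>(v, r)\<in>V \<times> {rad V E - 1}. gdist E v x \<le> r"
    by (intro helly_balls) auto
  then obtain x where x: "x \<in> V" "\<And>v. v \<in> V \<Longrightarrow> gdist E v x \<le> rad V E - 1"
    by auto
  then have "ecc V E x \<le> rad V E - 1"
    using gdist_sym by (intro ecc_leI) metis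
  then show False
    using rad_le_ecc[OF x(1)] less by simp
qed

text \<open>The balls of radius \<open>rad\<close> around all vertices meet in the center. The two further balls,
  around \<open>v\<close> and \<open>c\<close>, select a central vertex that is both nearest to \<open>v\<close> and close to \<open>c\<close>.\<close>
lemma central_vertex_towards:
  assumes "v \<in> V" "c \<in> V"
  obtains w where "w \<in> V" "ecc V E w \<le> rad V E" "gdist E v w \<le> ecc V E v - rad V E"
    "gdist E c w \<le> max (gdist E c v - (ecc V E v - rad V E)) (ecc V E c - rad V E)"
proof -
  define R where "R = rad V E"
  define p where "p = ecc V E v - R"
  \<comment> \<open>The least radius for which the ball around \<open>c\<close> meets the ball of
    radius \<open>p\<close> around \<open>v\<close> and every ball of radius
    \<open>R\<close>.\<close>
  define q where "q = max (gdist E c v - p) (ecc V E c - R)"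
  have R: "R \<le> ecc V E u" if "u \<in> V" for u
    using rad_le_ecc that by (simp add: R_def)
  obtain z where z: "z \<in> V" "ecc V E z = R"
    using rad_attained R_def by metis
  have "gdist E u w \<le> R + R" if "u \<in> V" "w \<in> V" for u w
    using gdist_triangle[of u z w] gdist_le_ecc[of u z] gdist_le_ecc[of w z] gdist_sym[of u z] z that
    by simp
  moreover have "gdist E u v \<le> R + p" "gdist E v u \<le> p + R" if "u \<in> V" for u
    using gdist_le_ecc[OF that, of v] R[OF assms(1)] gdist_sym[of u v] by (auto simp: p_def)
  moreover have "gdist E u c \<le> R + q" "gdist E c u \<le> q + R" if "u \<in> V" for u
    using gdist_le_ecc[OF that, of c] R[OF assms(2)] gdist_sym[of u c] by (auto simp: q_def)
  moreover have "gdist E v c \<le> p + q" "gdist E c v \<le> q + p"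
    using gdist_sym[of v c] by (auto simp: q_def)
  ultimately have "gdist E u w \<le> r + s"
    if "(u, r) \<in> V \<times> {R} \<union> {(v, p), (c, q)}" "(w, s) \<in> V \<times> {R} \<union> {(v, p), (c, q)}" for u w r s
    using that by auto
  then have "\<exists>x\<in>V. \<forall>(u, r)\<in>V \<times> {R} \<union> {(v, p), (c, q)}. gdist E u x \<le> r"
    using assms by (intro helly_balls) auto
  then obtain x where x: "x \<in> V" "\<And>u. u \<in> V \<Longrightarrow> gdist E u x \<le> R" "gdist E v x \<le> p" "gdist E c x \<le> q"
    by auto
  have "ecc V E x \<le> R"
    using x(2) gdist_sym by (intro ecc_leI) metis
  then show ?thesis
    using that[of x] x by (simp add: p_def q_def R_def)
qed

text \<open>Either some \<open>u\<close> yields the exact eccentricity of \<open>v\<close>, or the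
  estimate for \<open>v\<close> is below \<open>2 * rad - 1\<close>. By
  \<open>two_rad_le_diam\<close> the latter value is too small to compete for the maximum.\<close>

lemma hitting_set_dichotomy:
  assumes "c \<in> V" "v \<in> V" "g < k" "3 * k < rad V E" "ecc V E c \<le> rad V E + k"
  obtains u where "u \<in> V" "u \<in> hitting_set k c g" "ecc V E u + gdist E u v \<le> ecc V E v"
  | u where "u \<in> V" "u \<in> hitting_set k c g" "ecc V E u + gdist E u v + 1 < 2 * rad V E"
proof -
  obtain w where w: "w \<in> V" "ecc V E w \<le> rad V E" "gdist E v w \<le> ecc V E v - rad V E"
    "gdist E c w \<le> max (gdist E c v - (ecc V E v - rad V E)) (ecc V E c - rad V E)"
    using central_vertex_towards[OF assms(2,1)] by metis
  have R: "rad V E \<le> ecc V E v"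
    using rad_le_ecc assms by blast
  \<comment> \<open>Suppose that the first case fails. If the second entry of the maximum in
    \<open>w(4)\<close> is the larger, \<open>w\<close> is within \<open>k\<close> of
    \<open>c\<close>, so \<open>v\<close> is within \<open>2 * k\<close>. Otherwise \<open>w\<close>
    is closer to \<open>c\<close> than \<open>v\<close> by the excess of \<open>ecc V E v\<close>
    over the radius, which is then less than \<open>k\<close>; if truncation makes that entry 0,
    \<open>v\<close> is near \<open>c\<close> again.\<close>
  consider "gdist E c w + k \<le> Suc (gdist E c v)" | "gdist E c v < 2 * k" | "ecc V E v < rad V E + k"
    using w(4) assms(5) by linarith
  then show ?thesis
  proof cases
    case 1
    then obtain u where u: "u \<in> V" "u \<in> hitting_set k c g" "gdist E v u + gdist E u w = gdist E v w"
      using geodesic_hits assms w by metis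
    have "ecc V E u \<le> gdist E u w + rad V E"
      using ecc_le_add_gdist[of u w] u w by simp
    \<comment> \<open>Since \<open>u\<close> lies on a shortest path from \<open>v\<close> to
      \<open>w\<close>, the two distances add up to \<open>gdist E v w\<close>, and \<open>w\<close>
      was chosen with \<open>gdist E v w + rad\<close> at most the eccentricity of
      \<open>v\<close>.\<close>
    then have "ecc V E u + gdist E u v \<le> ecc V E v"
      using u w R gdist_sym[of u v] by simp
    then show ?thesis
      using that(1) u by blast
  next
    case 2
    then show ?thesis
      using that(2)[of c] assms by (simp add: hitting_set_def)
  next
    case 3
    obtain u where u: "u \<in> V" "u \<in> hitting_set k c g" "gdist E v u < k"
      using hitting_set_dominates[OF assms(1-3)] by metis
    then have "ecc V E u + gdist E u v + 1 < 2 * rad V E"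
      using ecc_le_add_gdist[of u v] gdist_sym[of u v] assms 3 by simp
    then show ?thesis
      using that(2) u by blast
  qed
qed

text \<open>As \<open>f\<close> overestimates, its maximum is at least the diameter. This excludes
  the second alternative of the dichotomy at \<open>x\<close>, and the first one makes the estimate
  at \<open>x\<close> exact.\<close>

lemma maximal_estimate_is_peripheral:
  assumes "c \<in> V" "g < k" "3 * k < rad V E" "ecc V E c \<le> rad V E + k"
    and lower: "\<And>v. v \<in> V \<Longrightarrow> ecc V E v \<le> f v"
    and upper: "\<And>u v. u \<in> hitting_set k c g \<Longrightarrow> u \<in> V \<Longrightarrow> v \<in> V \<Longrightarrow> f v \<le> ecc V E u + gdist E u v"
    and x: "x \<in> V" "\<And>v. v \<in> V \<Longrightarrow> f v \<le> f x"
  shows "ecc V E x = diam V E"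
proof -
  obtain v where "v \<in> V" "ecc V E v = diam V E"
    by (rule diam_attained)
  then have diam: "diam V E \<le> f x"
    using lower x(2) le_trans by metis
  have "f x \<le> ecc V E x"
    using hitting_set_dichotomy[OF assms(1) x(1) assms(2-4)]
  proof cases
    case (1 u)
    then show ?thesis
      using upper x(1) le_trans by metis
  next
    case (2 u)
    then show ?thesis
      using upper[of u x] x(1) diam two_rad_le_diam by force
  qed
  then show ?thesis
    using diam ecc_le_diam[OF x(1)] by simp
qed

end

section \<open>Deterministic programs with bounded values\<close>

definition bounded_store :: "nat \<Rightarrow> store \<Rightarrow> bool" where
  "bounded_store B s \<longleftrightarrow> (\<forall>x. var s x \<le> B) \<and> (\<forall>a i. arr s a i \<le> B)"

text \<open>In a bounded store, only constants, sums and products can exceed the bound.\<close>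
primrec fits :: "nat \<Rightarrow> store \<Rightarrow> exp \<Rightarrow> bool" where
  "fits B s (Const i) = (i \<le> B)"
| "fits B s (Var x) = True"
| "fits B s (Read a e) = fits B s e"
| "fits B s (Add e f) = (fits B s e \<and> fits B s f \<and> eval s e + eval s f \<le> B)"
| "fits B s (Sub e f) = (fits B s e \<and> fits B s f)"
| "fits B s (Mul e f) = (fits B s e \<and> fits B s f \<and> eval s e * eval s f \<le> B)"
| "fits B s (Div e f) = (fits B s e \<and> fits B s f)"

primrec exp_size :: "exp \<Rightarrow> nat" where
  "exp_size (Const i) = 1"
| "exp_size (Var x) = 1"
| "exp_size (Read a e) = exp_size e + 1"
| "exp_size (Add e f) = exp_size e + exp_size f + 1"
| "exp_size (Sub e f) = exp_size e + exp_size f + 1"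
| "exp_size (Mul e f) = exp_size e + exp_size f + 1"
| "exp_size (Div e f) = exp_size e + exp_size f + 1"

lemma eval_le: "bounded_store B s \<Longrightarrow> fits B s e \<Longrightarrow> eval s e \<le> B"
proof (induction e)
  case (Div e f)
  then show ?case
    by (auto intro: le_trans[OF div_le_dividend])
qed (auto simp: bounded_store_def)

lemma value_cost_mono: "i \<le> j \<Longrightarrow> value_cost i \<le> value_cost j"
  by (simp add: value_cost_def floorlog_mono)

lemma eval_cost_le:
  assumes "bounded_store B s"
  shows "fits B s e \<Longrightarrow> eval_cost s e \<le> exp_size e * value_cost B"
proof (induction e)
  case (Const i)
  then show ?case
    by (simp add: value_cost_mono)
next
  case (Var x)
  then show ?case
    using assms by (simp add: value_cost_mono bounded_store_def)
next
  case (Read a e)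
  then show ?case
    using value_cost_mono[OF eval_le[OF assms Read.prems]] by (simp add: add_mult_distrib)
next
  case (Add e f)
  then show ?case
    using value_cost_mono[OF eval_le[OF assms Add.prems]] by (simp add: add_mult_distrib)
next
  case (Sub e f)
  then show ?case
    using value_cost_mono[OF eval_le[OF assms Sub.prems]] by (simp add: add_mult_distrib)
next
  case (Mul e f)
  then show ?case
    using value_cost_mono[OF eval_le[OF assms Mul.prems]] by (simp add: add_mult_distrib)
next
  case (Div e f)
  then show ?case
    using value_cost_mono[OF eval_le[OF assms Div.prems]] by (simp add: add_mult_distrib)
qed

lemma store_simps [simp]:
  "var (set_var x i s) y = (if y = x then i else var s y)"
  "arr (set_var x i s) = arr s"
  "var (set_arr a j i s) = var s"
  "arr (set_arr a j i s) b = (if b = a then (arr s a)(j := i) else arr s b)"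
  by (auto simp: set_var_def set_arr_def)

text \<open>Big-step semantics without coin flips. The cost charges one unit for every value, so that the
  logarithmic cost is at most \<open>value_cost B\<close> times as large.\<close>
inductive exec :: "nat \<Rightarrow> com \<Rightarrow> store \<Rightarrow> nat \<Rightarrow> store \<Rightarrow> bool" for B where
  Skip: "exec B Skip s 1 s"
| Assign: "fits B s e \<Longrightarrow> exec B (Assign x e) s (1 + exp_size e) (set_var x (eval s e) s)"
| Store: "fits B s e \<Longrightarrow> fits B s f \<Longrightarrow>
    exec B (Store a e f) s (1 + exp_size e + exp_size f) (set_arr a (eval s e) (eval s f) s)"
| Seq: "exec B c s u s' \<Longrightarrow> exec B d s' v s'' \<Longrightarrow> exec B (Seq c d) s (1 + u + v) s''"
| Cond: "fits B s e \<Longrightarrow> exec B (if eval s e \<noteq> 0 then c else d) s u s' \<Longrightarrow>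
    exec B (Cond e c d) s (1 + exp_size e + u) s'"
| While_done: "fits B s e \<Longrightarrow> eval s e = 0 \<Longrightarrow> exec B (While e c) s (1 + exp_size e) s"
| While_step: "fits B s e \<Longrightarrow> eval s e \<noteq> 0 \<Longrightarrow> exec B c s u s' \<Longrightarrow> exec B (While e c) s' v s'' \<Longrightarrow>
    exec B (While e c) s (1 + exp_size e + u + v) s''"

inductive_cases exec_SkipE: "exec B Skip s u s'"
inductive_cases exec_AssignE: "exec B (Assign x e) s u s'"
inductive_cases exec_StoreE: "exec B (Store a e f) s u s'"
inductive_cases exec_SeqE: "exec B (Seq c d) s u s'"
inductive_cases exec_CondE: "exec B (Cond e c d) s u s'"

section \<open>Simulation of terminating executions by the probabilistic machine\<close>

abbreviation steps :: "nat \<Rightarrow> config pmf \<Rightarrow> config pmf" where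
  "steps N \<equiv> (\<lambda>p. bind_pmf p step) ^^ N"

text \<open>Here \<open>t\<close> is the exact time and \<open>T\<close> an upper bound. The
  arbitrary starting time \<open>t0\<close> allows runs to be chained, and bounding the number of
  steps by \<open>t\<close> ensures that the \<open>T\<close> steps of \<open>run T\<close>
  suffice.\<close>

definition reaches :: "nat \<Rightarrow> com list \<Rightarrow> store \<Rightarrow> nat \<Rightarrow> com list \<Rightarrow> store \<Rightarrow> bool" where
  "reaches T cs s t cs' s' \<longleftrightarrow> t \<le> T \<and>
     (\<exists>N\<le>t. \<forall>t0. steps N (return_pmf (cs, s, t0)) = return_pmf (cs', s', t0 + t))"

lemma reaches_trans:
  assumes "reaches T cs s t cs' s'" "reaches T' cs' s' t' cs'' s''"
  shows "reaches (T + T') cs s (t + t') cs'' s''"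
proof -
  obtain N N' where N: "N \<le> t" "N' \<le> t'"
    "\<And>t0. steps N (return_pmf (cs, s, t0)) = return_pmf (cs', s', t0 + t)"
    "\<And>t0. steps N' (return_pmf (cs', s', t0)) = return_pmf (cs'', s'', t0 + t')"
    using assms unfolding reaches_def by blast
  have "steps (N' + N) (return_pmf (cs, s, t0)) = return_pmf (cs'', s'', t0 + (t + t'))" for t0
    unfolding funpow_add by (simp add: N add.assoc)
  moreover have "N' + N \<le> t + t'"
    using N by simp
  ultimately show ?thesis
    using assms unfolding reaches_def by (intro conjI exI[of _ "N' + N"]) auto
qed

lemma reaches_step:
  assumes "\<And>t0. step (cs, s, t0) = return_pmf (cs', s', t0 + t)" "0 < t" "t \<le> T"
  shows "reaches T cs s t cs' s'"
  unfolding reaches_def using assms by (intro conjI exI[of _ 1]) (auto simp: bind_return_pmf)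

lemma value_cost_pos: "1 \<le> value_cost B"
  by (simp add: value_cost_def)

text \<open>All values met are at most \<open>B\<close>, so each unit of abstract cost pays for one
  value or for the dispatch of a command. The time \<open>t\<close> is chosen before the stack
  \<open>cs\<close>, because it must not depend on what is executed afterwards.\<close>

lemma exec_reaches:
  assumes "exec B c s u s'" "bounded_store B s"
  shows "bounded_store B s' \<and> (\<exists>t. \<forall>cs. reaches (u * value_cost B) (c # cs) s t cs s')"
  using assms
proof (induction rule: exec.induct)
  case (Skip s)
  have "reaches (1 * value_cost B) (com.Skip # cs) s 1 cs s" for cs
    using value_cost_pos by (intro reaches_step) auto
  then show ?case
    using Skip by blast
next
  case (Assign s e x)
  have "reaches ((1 + exp_size e) * value_cost B) (com.Assign x e # cs) s (1 + eval_cost s e) cs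
      (set_var x (eval s e) s)" for cs
    using value_cost_pos[of B] eval_cost_le[OF Assign.prems Assign.hyps]
    by (intro reaches_step) (auto simp: add_mult_distrib)
  moreover have "bounded_store B (set_var x (eval s e) s)"
    using Assign eval_le by (simp add: bounded_store_def)
  ultimately show ?case
    by blast
next
  case (Store s e f a)
  have "reaches ((1 + exp_size e + exp_size f) * value_cost B) (com.Store a e f # cs) s
      (1 + eval_cost s e + eval_cost s f) cs (set_arr a (eval s e) (eval s f) s)" for cs
    using value_cost_pos[of B] eval_cost_le[OF Store.prems Store.hyps(1)]
      eval_cost_le[OF Store.prems Store.hyps(2)]
    by (intro reaches_step) (auto simp: add_mult_distrib)
  moreover have "bounded_store B (set_arr a (eval s e) (eval s f) s)"
    using Store eval_le by (simp add: bounded_store_def)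
  ultimately show ?case
    by blast
next
  case (Seq c s u s' d v s'')
  obtain t where t: "\<And>cs. reaches (u * value_cost B) (c # cs) s t cs s'"
    using Seq by blast
  obtain t' where t': "\<And>cs. reaches (v * value_cost B) (d # cs) s' t' cs s''"
    using Seq by blast
  have "reaches (1 * value_cost B) (com.Seq c d # cs) s 1 (c # d # cs) s" for cs
    using value_cost_pos by (intro reaches_step) auto
  from reaches_trans[OF reaches_trans[OF this t] t']
  have "reaches ((1 + u + v) * value_cost B) (com.Seq c d # cs) s (1 + t + t') cs s''" for cs
    by (simp add: add_mult_distrib add.assoc)
  then show ?case
    using Seq by blast
next
  case (Cond s e c d u s')
  let ?c = "if eval s e \<noteq> 0 then c else d"
  obtain t where t: "\<And>cs. reaches (u * value_cost B) (?c # cs) s t cs s'"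
    using Cond by blast
  have "reaches ((1 + exp_size e) * value_cost B) (com.Cond e c d # cs) s (1 + eval_cost s e)
      (?c # cs) s" for cs
    using value_cost_pos[of B] eval_cost_le[OF Cond.prems Cond.hyps(1)]
    by (intro reaches_step) (auto simp: add_mult_distrib)
  from reaches_trans[OF this t]
  have "reaches ((1 + exp_size e + u) * value_cost B) (com.Cond e c d # cs) s
      (1 + eval_cost s e + t) cs s'" for cs
    by (simp add: add_mult_distrib add.assoc)
  then show ?case
    using Cond by blast
next
  case (While_done s e c)
  have "reaches ((1 + exp_size e) * value_cost B) (While e c # cs) s (1 + eval_cost s e) cs s" for cs
    using value_cost_pos[of B] eval_cost_le[OF While_done.prems While_done.hyps(1)] While_done
    by (intro reaches_step) (auto simp: add_mult_distrib)
  then show ?case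
    using While_done by blast
next
  case (While_step s e c u s' v s'')
  obtain t where t: "\<And>cs. reaches (u * value_cost B) (c # cs) s t cs s'"
    using While_step by blast
  obtain t' where t': "\<And>cs. reaches (v * value_cost B) (While e c # cs) s' t' cs s''"
    using While_step by blast
  have "reaches ((1 + exp_size e) * value_cost B) (While e c # cs) s (1 + eval_cost s e)
      (c # While e c # cs) s" for cs
    using value_cost_pos[of B] eval_cost_le[OF While_step.prems While_step.hyps(1)] While_step
    by (intro reaches_step) (auto simp: add_mult_distrib)
  from reaches_trans[OF reaches_trans[OF this t] t']
  have "reaches ((1 + exp_size e + u + v) * value_cost B) (While e c # cs) s
      (1 + eval_cost s e + t + t') cs s''" for cs
    by (simp add: add_mult_distrib add.assoc)
  then show ?case
    using While_step by blast
qed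

lemma steps_halted: "steps N (return_pmf ([], s, t)) = return_pmf ([], s, t)"
  by (induction N) (auto simp: bind_return_pmf)

lemma exec_success_prob:
  assumes "exec B P s u s'" "bounded_store B s" "u * value_cost B \<le> T" "Q s'"
  shows "success_prob P s T Q = 1"
proof -
  obtain t where "reaches (u * value_cost B) [P] s t [] s'"
    using exec_reaches assms(1,2) by blast
  then obtain N where N: "N \<le> t" "t \<le> T" "steps N (return_pmf ([P], s, 0)) = return_pmf ([], s', t)"
    using assms(3) unfolding reaches_def by fastforce
  \<comment> \<open>\<open>run\<close> makes exactly \<open>T\<close> steps; those after the first
    \<open>N\<close> leave the halted configuration unchanged.\<close>
  have "run T P s = steps (T - N + N) (return_pmf ([P], s, 0))"
    unfolding run_def using N by simp
  also have "\<dots> = return_pmf ([], s', t)"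
    unfolding funpow_add by (simp add: N steps_halted)
  finally show ?thesis
    unfolding success_prob_def using N assms(4) by (simp add: indicator_def)
qed

section \<open>Verification rules\<close>

primrec written_vars :: "com \<Rightarrow> vname set" where
  "written_vars Skip = {}"
| "written_vars (Assign x e) = {x}"
| "written_vars (Store a e f) = {}"
| "written_vars (Flip x) = {x}"
| "written_vars (Seq c d) = written_vars c \<union> written_vars d"
| "written_vars (Cond e c d) = written_vars c \<union> written_vars d"
| "written_vars (While e c) = written_vars c"

primrec written_arrs :: "com \<Rightarrow> vname set" where
  "written_arrs Skip = {}"
| "written_arrs (Assign x e) = {}"
| "written_arrs (Store a e f) = {a}"
| "written_arrs (Flip x) = {}"
| "written_arrs (Seq c d) = written_arrs c \<union> written_arrs d"
| "written_arrs (Cond e c d) = written_arrs c \<union> written_arrs d"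
| "written_arrs (While e c) = written_arrs c"

definition same_except :: "vname set \<Rightarrow> vname set \<Rightarrow> store \<Rightarrow> store \<Rightarrow> bool" where
  "same_except X A s s' \<longleftrightarrow>
     (\<forall>x. x \<notin> X \<longrightarrow> var s' x = var s x) \<and> (\<forall>a. a \<notin> A \<longrightarrow> arr s' a = arr s a)"

lemma same_exceptD:
  assumes "same_except X A s s'"
  shows "x \<notin> X \<Longrightarrow> var s' x = var s x" "a \<notin> A \<Longrightarrow> arr s' a = arr s a"
  using assms by (auto simp: same_except_def)

lemma same_except_refl: "same_except X A s s"
  by (simp add: same_except_def)

lemma same_except_trans:
  "same_except X A s s' \<Longrightarrow> same_except Y D s' s'' \<Longrightarrow> X \<subseteq> Z \<Longrightarrow> Y \<subseteq> Z \<Longrightarrow> A \<subseteq> F \<Longrightarrow> D \<subseteq> F \<Longrightarrow>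
     same_except Z F s s''"
  unfolding same_except_def by (metis subsetD)

lemma exec_same_except:
  "exec B c s u s' \<Longrightarrow> same_except (written_vars c) (written_arrs c) s s'"
proof (induction rule: exec.induct)
  case (Store s e f a)
  show ?case
    by (auto simp: same_except_def fun_eq_iff)
qed (auto simp: same_except_def split: if_splits)

text \<open>The postcondition \<open>K\<close> also receives the part of the budget \<open>u\<close> that is left over, so that the
  rule for sequential composition is an equivalence.\<close>
definition wp :: "nat \<Rightarrow> com \<Rightarrow> (nat \<Rightarrow> store \<Rightarrow> bool) \<Rightarrow> nat \<Rightarrow> store \<Rightarrow> bool" where
  "wp B c K u s \<longleftrightarrow> (\<exists>v s'. exec B c s v s' \<and> v \<le> u \<and> K (u - v) s')"

lemma wp_Skip [simp]: "wp B Skip K u s \<longleftrightarrow> 1 \<le> u \<and> K (u - 1) s"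
  unfolding wp_def by (metis exec.Skip exec_SkipE)

lemma wp_Assign [simp]:
  "wp B (Assign x e) K u s \<longleftrightarrow>
     fits B s e \<and> 1 + exp_size e \<le> u \<and> K (u - (1 + exp_size e)) (set_var x (eval s e) s)"
  unfolding wp_def by (metis exec.Assign exec_AssignE)

lemma wp_Store [simp]:
  "wp B (Store a e f) K u s \<longleftrightarrow>
     fits B s e \<and> fits B s f \<and> 1 + exp_size e + exp_size f \<le> u \<and>
     K (u - (1 + exp_size e + exp_size f)) (set_arr a (eval s e) (eval s f) s)"
  unfolding wp_def by (metis exec.Store exec_StoreE)

lemma wp_Seq [simp]: "wp B (Seq c d) K u s \<longleftrightarrow> 1 \<le> u \<and> wp B c (wp B d K) (u - 1) s"
proof
  assume "wp B (Seq c d) K u s"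
  then obtain t s'' where "exec B (Seq c d) s t s''" "t \<le> u" "K (u - t) s''"
    unfolding wp_def by blast
  then obtain v w s' where "exec B c s v s'" "exec B d s' w s''" "1 + v + w \<le> u"
    "K (u - (1 + v + w)) s''"
    by (auto elim!: exec_SeqE)
  then show "1 \<le> u \<and> wp B c (wp B d K) (u - 1) s"
    unfolding wp_def by (intro conjI exI[of _ v] exI[of _ s'] exI[of _ w] exI[of _ s'']) auto
next
  assume "1 \<le> u \<and> wp B c (wp B d K) (u - 1) s"
  then obtain v w s' s'' where "exec B c s v s'" "exec B d s' w s''" "1 + v + w \<le> u"
    "K (u - (1 + v + w)) s''"
    unfolding wp_def by force
  then show "wp B (Seq c d) K u s"
    unfolding wp_def using exec.Seq by blast
qed

lemma wp_Cond [simp]: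
  "wp B (Cond e c d) K u s \<longleftrightarrow> fits B s e \<and> 1 + exp_size e \<le> u \<and>
     (if eval s e \<noteq> 0 then wp B c K (u - (1 + exp_size e)) s else wp B d K (u - (1 + exp_size e)) s)"
proof
  assume "wp B (Cond e c d) K u s"
  then obtain t s' where "exec B (Cond e c d) s t s'" "t \<le> u" "K (u - t) s'"
    unfolding wp_def by blast
  then obtain v where "fits B s e" "exec B (if eval s e \<noteq> 0 then c else d) s v s'"
    "1 + exp_size e + v \<le> u" "K (u - (1 + exp_size e + v)) s'"
    by (auto elim!: exec_CondE)
  then show "fits B s e \<and> 1 + exp_size e \<le> u \<and>
     (if eval s e \<noteq> 0 then wp B c K (u - (1 + exp_size e)) s else wp B d K (u - (1 + exp_size e)) s)"
    unfolding wp_def by (auto intro!: exI[of _ v] exI[of _ s'])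
next
  assume *: "fits B s e \<and> 1 + exp_size e \<le> u \<and>
     (if eval s e \<noteq> 0 then wp B c K (u - (1 + exp_size e)) s else wp B d K (u - (1 + exp_size e)) s)"
  then obtain v s' where "exec B (if eval s e \<noteq> 0 then c else d) s v s'"
    "1 + exp_size e + v \<le> u" "K (u - (1 + exp_size e + v)) s'"
    unfolding wp_def by (auto split: if_splits)
  then show "wp B (Cond e c d) K u s"
    unfolding wp_def using exec.Cond * by blast
qed

text \<open>Besides weakening the postcondition, this enlarges the budget, whose surplus is handed
  on, and supplies the frame condition. Specifications therefore need not mention what a program
  leaves untouched.\<close>

lemma wp_conseq:
  assumes "wp B c K w s" "w \<le> u"
    and "\<And>v v' s'. K v' s' \<Longrightarrow> v = v' + (u - w) \<Longrightarrow>
      same_except (written_vars c) (written_arrs c) s s' \<Longrightarrow> K' v s'"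
  shows "wp B c K' u s"
proof -
  obtain v s' where v: "exec B c s v s'" "v \<le> w" "K (w - v) s'"
    using assms(1) unfolding wp_def by blast
  have "K' (u - v) s'"
    using assms(3)[OF v(3) _ exec_same_except[OF v(1)]] v(2) assms(2) by force
  then show ?thesis
    unfolding wp_def using v assms(2) by (intro exI[of _ v] exI[of _ s']) auto
qed

notation Seq (infixr ";;" 60)

lemma wp_SeqI:
  assumes "wp B c K w s" "w < u"
    and "\<And>v v' s'. K v' s' \<Longrightarrow> v = v' + (u - 1 - w) \<Longrightarrow>
      same_except (written_vars c) (written_arrs c) s s' \<Longrightarrow> wp B d K' v s'"
  shows "wp B (c ;; d) K' u s"
  using assms wp_conseq[OF assms(1), of "u - 1" "wp B d K'"] by auto

lemma wp_While_unfold: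
  assumes "fits B s e" "1 + exp_size e \<le> u"
    and "eval s e = 0 \<Longrightarrow> K (u - (1 + exp_size e)) s"
    and "eval s e \<noteq> 0 \<Longrightarrow> wp B c (wp B (While e c) K) (u - (1 + exp_size e)) s"
  shows "wp B (While e c) K u s"
proof (cases "eval s e = 0")
  case True
  then show ?thesis
    unfolding wp_def using exec.While_done[OF assms(1), of c] assms by blast
next
  case False
  then obtain v s' w s'' where "exec B c s v s'" "v \<le> u - (1 + exp_size e)"
    "exec B (While e c) s' w s''" "w \<le> u - (1 + exp_size e) - v" "K (u - (1 + exp_size e) - v - w) s''"
    using assms(4) unfolding wp_def by blast
  then show ?thesis
    unfolding wp_def using exec.While_step[OF assms(1) False, of c v s' w s''] assms(2)
    by (intro exI[of _ "1 + exp_size e + v + w"] exI[of _ s'']) auto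
qed

text \<open>An amortized rule: each iteration, its test included, is paid for by a drop of the
  potential \<open>\<Phi>\<close>. It serves loops whose iterations differ in cost, such as the
  queue loop of the search.\<close>

lemma wp_While:
  fixes \<Phi> :: "store \<Rightarrow> nat"
  assumes init: "I s" "1 + exp_size e + \<Phi> s \<le> u"
    and fits: "\<And>s'. same_except (written_vars c) (written_arrs c) s s' \<Longrightarrow> I s' \<Longrightarrow> fits B s' e"
    and body: "\<And>s'. same_except (written_vars c) (written_arrs c) s s' \<Longrightarrow> I s' \<Longrightarrow> eval s' e \<noteq> 0 \<Longrightarrow>
      wp B c (\<lambda>_ s''. I s'' \<and> \<Phi> s'' + w s' + 1 + exp_size e \<le> \<Phi> s') (w s') s'"
    and exit: "\<And>v s'. same_except (written_vars c) (written_arrs c) s s' \<Longrightarrow>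
      u \<le> v + (1 + exp_size e + \<Phi> s) \<Longrightarrow> I s' \<Longrightarrow> eval s' e = 0 \<Longrightarrow> K v s'"
  shows "wp B (While e c) K u s"
proof -
  \<comment> \<open>The last premise says that no more has been spent than the potential has
    dropped, which provides the remaining budget claimed in \<open>exit\<close>.\<close>
  have "wp B (While e c) K v s'"
    if "same_except (written_vars c) (written_arrs c) s s'" "I s'" "1 + exp_size e + \<Phi> s' \<le> v"
      "u + \<Phi> s' \<le> v + \<Phi> s" for s' v
    using that
  proof (induction "\<Phi> s'" arbitrary: s' v rule: less_induct)
    case less
    show ?case
    proof (rule wp_While_unfold)
      show "fits B s' e" "1 + exp_size e \<le> v"
        using less fits by auto
      show "K (v - (1 + exp_size e)) s'" if "eval s' e = 0"
        using less that by (intro exit) auto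
      assume "eval s' e \<noteq> 0"
      then obtain t s'' where t: "exec B c s' t s''" "t \<le> w s'" "I s''"
        "\<Phi> s'' + w s' + 1 + exp_size e \<le> \<Phi> s'"
        using body[OF less.prems(1,2)] unfolding wp_def by blast
      have "wp B (While e c) K (v - (1 + exp_size e) - t) s''"
        using t less.prems same_except_trans[OF less.prems(1) exec_same_except[OF t(1)]]
        by (intro less.hyps) auto
      then show "wp B c (wp B (While e c) K) (v - (1 + exp_size e)) s'"
        unfolding wp_def[of B c] using t less.prems by (intro exI[of _ t] exI[of _ s'']) auto
    qed
  qed
  then show ?thesis
    using init same_except_refl by simp
qed

definition For :: "vname \<Rightarrow> vname \<Rightarrow> com \<Rightarrow> com" where
  "For x y c = While (Sub (Var y) (Var x)) (Seq c (Assign x (Add (Var x) (Const 1))))"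

lemma written_For [simp]:
  "written_vars (For x y c) = insert x (written_vars c)"
  "written_arrs (For x y c) = written_arrs c"
  by (auto simp: For_def)

text \<open>The overhead of 9 per iteration is 4 for the test, 1 for the sequential composition and
  4 for the increment; the final 4 pays for the failing test. The body has to establish the
  invariant for the store after the increment.\<close>

lemma wp_For:
  assumes vars: "x \<notin> written_vars c" "y \<notin> written_vars c" "x \<noteq> y"
    and init: "var s x = a" "var s y = b" "a \<le> b" "b \<le> B" "1 \<le> B" "I a s"
    and cost: "(\<Sum>i = a..<b. w i + 9) + 4 \<le> u"
    and body: "\<And>i s'. same_except (insert x (written_vars c)) (written_arrs c) s s' \<Longrightarrow>
      a \<le> i \<Longrightarrow> i < b \<Longrightarrow> var s' x = i \<Longrightarrow> var s' y = b \<Longrightarrow> I i s' \<Longrightarrow>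
      wp B c (\<lambda>_ s''. I (Suc i) (set_var x (Suc i) s'')) (w i) s'"
    and exit: "\<And>v s'. same_except (insert x (written_vars c)) (written_arrs c) s s' \<Longrightarrow>
      u \<le> v + ((\<Sum>i = a..<b. w i + 9) + 4) \<Longrightarrow> var s' x = b \<Longrightarrow> I b s' \<Longrightarrow> K v s'"
  shows "wp B (For x y c) K u s"
proof -
  let ?S = "\<lambda>i. \<Sum>j = i..<b. w j + 9"
  have "wp B (For x y c) K v s'"
    if "a \<le> i" "i \<le> b" "same_except (insert x (written_vars c)) (written_arrs c) s s'"
      "var s' x = i" "var s' y = b" "I i s'" "?S i + 4 \<le> v" "u + ?S i \<le> v + ?S a" for i s' v
    using that
  proof (induction "b - i" arbitrary: i s' v)
    case 0
    then have "i = b"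
      by simp
    then show ?case
      unfolding For_def using 0 by (intro wp_While_unfold) (auto intro!: exit)
  next
    case (Suc d)
    then have less: "i < b"
      by simp
    have S: "?S i = w i + 9 + ?S (Suc i)"
      using less by (simp add: sum.atLeast_Suc_lessThan)
    have wp: "wp B c (\<lambda>_ s''. I (Suc i) (set_var x (Suc i) s'')) (w i) s'"
      using Suc less by (intro body) auto
    show ?case
      unfolding For_def
    proof (rule wp_While_unfold)
      let ?inc = "Assign x (Add (Var x) (Const 1))"
      let ?K = "wp B (While (Sub (Var y) (Var x)) (Seq c ?inc)) K"
      have "wp B c (wp B ?inc ?K) (v - 4 - 1) s'"
        using wp
      proof (rule wp_conseq)
        show "w i \<le> v - 4 - 1"
          using Suc.prems S by simp
        fix v1 v' s1
        assume s1: "I (Suc i) (set_var x (Suc i) s1)" "v1 = v' + (v - 4 - 1 - w i)"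
          "same_except (written_vars c) (written_arrs c) s' s1"
        have x: "var s1 x = i" "var s1 y = b"
          using same_exceptD(1)[OF s1(3)] vars Suc.prems by auto
        have "same_except (insert x (written_vars c)) (written_arrs c) s (set_var x (Suc i) s1)"
          using Suc.prems(3) s1(3) by (auto simp: same_except_def)
        then have "wp B (For x y c) K (v1 - 4) (set_var x (Suc i) s1)"
          using Suc s1 x less S vars by (intro Suc.hyps(1)[of "Suc i"]) auto
        then show "wp B ?inc ?K v1 s1"
          using x less init s1 Suc.prems S by (simp add: For_def)
      qed
      moreover have "1 + exp_size (Sub (Var y) (Var x)) = 4" "1 \<le> v - 4"
        using Suc.prems S by auto
      ultimately show "wp B (Seq c ?inc) ?K (v - (1 + exp_size (Sub (Var y) (Var x)))) s'"
        unfolding wp_Seq by metis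
    qed (use Suc less in auto)
  qed
  from this[of a s u] show ?thesis
    using init cost same_except_refl by simp
qed

section \<open>Breadth-first search\<close>

locale listed_graph = conn_graph "{..<n}" E for n :: nat and E :: "nat set set" +
  fixes L :: "nat \<Rightarrow> nat list"
  assumes adj_lists: "adj_lists n E L"
begin

abbreviation dist :: "nat \<Rightarrow> nat \<Rightarrow> nat" where
  "dist \<equiv> gdist E"

abbreviation eccentricity :: "nat \<Rightarrow> nat" where
  "eccentricity \<equiv> ecc {..<n} E"

lemma n_pos: "0 < n"
  using V_nonempty by auto

lemma dist_less: "u < n \<Longrightarrow> v < n \<Longrightarrow> dist u v < n"
  using gdist_less_card[of u v] by simp

lemma eccentricity_less: "u < n \<Longrightarrow> eccentricity u < n"
  using ecc_less_card[of u] by simp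

lemma set_L: "v < n \<Longrightarrow> w \<in> set (L v) \<longleftrightarrow> (v, w) \<in> adjacency E"
  using adj_lists by (simp add: adj_lists_def adjacency_def)

lemma set_L_less: "v < n \<Longrightarrow> w \<in> set (L v) \<Longrightarrow> w < n"
  using set_L edge_in_V by blast

text \<open>The queue is \<open>Q[0], \<dots>, Q[t - 1]\<close>, and the vertices before position \<open>h\<close> have been scanned.
  Unvisited vertices have the label \<open>n\<close>.\<close>
definition bfs_inv :: "nat \<Rightarrow> nat \<Rightarrow> nat \<Rightarrow> (nat \<Rightarrow> nat) \<Rightarrow> (nat \<Rightarrow> nat) \<Rightarrow> bool" where
  "bfs_inv r h t D Q \<longleftrightarrow> h \<le> t \<and> inj_on Q {..<t} \<and> Q ` {..<t} \<subseteq> {..<n} \<and> r \<in> Q ` {..<t} \<and>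
     (\<forall>v<n. D v = (if v \<in> Q ` {..<t} then dist r v else n)) \<and>
     (\<forall>i j. i \<le> j \<longrightarrow> j < t \<longrightarrow> dist r (Q i) \<le> dist r (Q j)) \<and>
     (h < t \<longrightarrow> (\<forall>i<t. dist r (Q i) \<le> Suc (dist r (Q h)))) \<and>
     (h < t \<longrightarrow> (\<forall>v<n. dist r v \<le> dist r (Q h) \<longrightarrow> v \<in> Q ` {..<t})) \<and>
     (\<forall>i<h. \<forall>w. (Q i, w) \<in> adjacency E \<longrightarrow> w \<in> Q ` {..<t})"

lemma bfs_invD:
  assumes "bfs_inv r h t D Q"
  shows "h \<le> t" "inj_on Q {..<t}" "\<And>i. i < t \<Longrightarrow> Q i < n" "r \<in> Q ` {..<t}" "r < n"
    "\<And>v. v < n \<Longrightarrow> D v = (if v \<in> Q ` {..<t} then dist r v else n)"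
    "\<And>i j. i \<le> j \<Longrightarrow> j < t \<Longrightarrow> dist r (Q i) \<le> dist r (Q j)"
    "\<And>i. h < t \<Longrightarrow> i < t \<Longrightarrow> dist r (Q i) \<le> Suc (dist r (Q h))"
    "\<And>v. h < t \<Longrightarrow> v < n \<Longrightarrow> dist r v \<le> dist r (Q h) \<Longrightarrow> v \<in> Q ` {..<t}"
    "\<And>i w. i < h \<Longrightarrow> (Q i, w) \<in> adjacency E \<Longrightarrow> w \<in> Q ` {..<t}"
  using assms unfolding bfs_inv_def by auto

lemma bfs_inv_init:
  assumes "r < n" "D r = 0" "\<And>v. v < n \<Longrightarrow> v \<noteq> r \<Longrightarrow> D v = n" "Q 0 = r"
  shows "bfs_inv r 0 1 D Q"
  using assms gdist_eq_0[of r] by (auto simp: bfs_inv_def lessThan_Suc)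

lemma bfs_inv_queue_le:
  assumes "bfs_inv r h t D Q"
  shows "t \<le> n"
proof -
  have "card (Q ` {..<t}) \<le> card {..<n}"
    using bfs_invD(3)[OF assms] by (intro card_mono) auto
  then show ?thesis
    using card_image[OF bfs_invD(2)[OF assms]] by simp
qed

text \<open>All vertices up to the level of \<open>Q h\<close> are queued, so a new neighbour of
  \<open>Q h\<close> lies exactly one level further. This justifies its label and keeps the queue
  sorted when it is appended.\<close>

lemma bfs_inv_visit:
  assumes inv: "bfs_inv r h t D Q" and ht: "h < t"
    and edge: "(Q h, w) \<in> adjacency E" and new: "w \<notin> Q ` {..<t}"
  shows "bfs_inv r h (Suc t) (D(w := Suc (D (Q h)))) (Q(t := w))"
proof -
  note D = bfs_invD[OF inv]
  have w: "w < n"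
    using edge edge_in_V by blast
  have "dist r w \<le> Suc (dist r (Q h))"
    using gdist_edge_le[OF _ edge, of r] D(5) by simp
  moreover have "\<not> dist r w \<le> dist r (Q h)"
    using D(9) ht w new by blast
  ultimately have dw: "dist r w = Suc (dist r (Q h))"
    by simp
  have Dh: "D (Q h) = dist r (Q h)"
    using D(6)[of "Q h"] D(3) ht by simp
  have img: "Q(t := w) ` {..<Suc t} = insert w (Q ` {..<t})"
    by (auto simp: image_def lessThan_Suc)
  have inj: "inj_on (Q(t := w)) {..<Suc t}"
    using D(2) new by (auto simp: inj_on_def lessThan_Suc)
  have sorted: "dist r ((Q(t := w)) i) \<le> dist r ((Q(t := w)) j)" if "i \<le> j" "j < Suc t" for i j
    using that D(7)[of i j] D(8)[of i] ht dw by (cases "j = t"; cases "i = t") auto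
  show ?thesis
    unfolding bfs_inv_def img
    using D inj sorted w dw Dh ht by (auto simp: less_Suc_eq)
qed

text \<open>The critical case is that the head moves to a new level. A vertex \<open>v\<close> of
  that level has a neighbour on the old level; this one is queued at a position up to
  \<open>h\<close>, hence scanned, so \<open>v\<close> is queued.\<close>

lemma bfs_inv_next:
  assumes inv: "bfs_inv r h t D Q" and ht: "h < t"
    and scanned: "\<And>w. (Q h, w) \<in> adjacency E \<Longrightarrow> w \<in> Q ` {..<t}"
  shows "bfs_inv r (Suc h) t D Q"
proof -
  note D = bfs_invD[OF inv]
  have near: "dist r (Q i) \<le> Suc (dist r (Q (Suc h)))" if "Suc h < t" "i < t" for i
    using D(8)[of i] D(7)[of h "Suc h"] that by simp
  have "v \<in> Q ` {..<t}" if less: "Suc h < t" and v: "v < n" "dist r v \<le> dist r (Q (Suc h))" for v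
  proof (cases "dist r v \<le> dist r (Q h)")
    case True
    then show ?thesis
      using D(9) ht v by blast
  next
    case False
    then have dv: "dist r v = Suc (dist r (Q h))" "dist r (Q h) < dist r (Q (Suc h))"
      using v D(8)[of "Suc h"] less by auto
    obtain p where p: "(v, p) \<in> adjacency E" "p < n" "dist r p = dist r (Q h)"
      using gdist_SucE[of v r "dist r (Q h)"] v dv D(5) gdist_sym by (metis lessThan_iff)
    then obtain i where i: "i < t" "p = Q i"
      using D(9)[of p] ht by auto
    then have "i \<le> h"
      using D(7)[of "Suc h" i] p dv by (metis leD not_less_eq_eq)
    then show ?thesis
      using D(10)[of i v] scanned[of v] p i adjacency_sym by (metis le_neq_implies_less)
  qed
  then show ?thesis
    unfolding bfs_inv_def using D near scanned ht by (auto simp: less_Suc_eq)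
qed

text \<open>By connectivity a fully scanned queue contains every vertex. Being sorted by distance,
  it ends with a farthest vertex, so the eccentricity can be read off without another loop.\<close>

lemma bfs_inv_final:
  assumes inv: "bfs_inv r t t D Q"
  shows "t = n" "\<And>v. v < n \<Longrightarrow> D v = dist r v" "Q (n - 1) < n"
    "dist r (Q (n - 1)) = eccentricity r"
proof -
  note D = bfs_invD[OF inv]
  have "v \<in> Q ` {..<t}" if "(r, v) \<in> (adjacency E)\<^sup>*" for v
    using that by (induction rule: rtrancl_induct) (use D(4,10) in auto)
  then have "{..<n} \<subseteq> Q ` {..<t}"
    using conn D(5) by (auto simp: connected_graph_def)
  then have all: "Q ` {..<t} = {..<n}"
    using D(3) by auto
  then show t: "t = n"
    using card_image[OF D(2)] by simp
  show "D v = dist r v" if "v < n" for v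
    using D(6) all that by auto
  show Q: "Q (n - 1) < n"
    using D(3) t n_pos by simp
  show "dist r (Q (n - 1)) = eccentricity r"
  proof (rule antisym)
    show "dist r (Q (n - 1)) \<le> eccentricity r"
      using gdist_le_ecc Q by simp
    show "eccentricity r \<le> dist r (Q (n - 1))"
    proof (rule ecc_leI)
      fix v assume "v \<in> {..<n}"
      then obtain i where "i < n" "v = Q i"
        using all t by blast
      then show "dist r v \<le> dist r (Q (n - 1))"
        using D(7)[of i "n - 1"] t n_pos by simp
    qed
  qed
qed

section \<open>The graph as represented in the store\<close>

definition offset :: "nat \<Rightarrow> nat" where
  "offset v = (\<Sum>u<v. length (L u))"

definition graph_loaded :: "store \<Rightarrow> bool" where
  "graph_loaded s \<longleftrightarrow> var s ''n'' = n \<and> (\<forall>v\<le>n. arr s ''off'' v = offset v) \<and>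
     (\<forall>v<n. \<forall>j<length (L v). arr s ''nbr'' (offset v + j) = L v ! j)"

lemma graph_loaded_set [simp]:
  "x \<noteq> ''n'' \<Longrightarrow> graph_loaded (set_var x i s) \<longleftrightarrow> graph_loaded s"
  "a \<noteq> ''off'' \<Longrightarrow> a \<noteq> ''nbr'' \<Longrightarrow> graph_loaded (set_arr a j i s) \<longleftrightarrow> graph_loaded s"
  by (simp_all add: graph_loaded_def)

lemma graph_loaded_same_except:
  "same_except X A s s' \<Longrightarrow> ''n'' \<notin> X \<Longrightarrow> ''off'' \<notin> A \<Longrightarrow> ''nbr'' \<notin> A \<Longrightarrow>
     graph_loaded s' \<longleftrightarrow> graph_loaded s"
  by (simp add: graph_loaded_def same_except_def)

lemma offset_Suc: "offset (Suc v) = offset v + length (L v)"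
  by (simp add: offset_def)

lemma offset_mono: "u \<le> v \<Longrightarrow> offset u \<le> offset v"
  unfolding offset_def by (intro sum_mono2) auto

end

text \<open>Distances are below \<open>n\<close> and unvisited vertices carry the label
  \<open>n\<close>, so the test succeeds exactly when \<open>w\<close> has been visited.\<close>

definition visit :: com where
  "visit = Assign ''w'' (Read ''nbr'' (Var ''i'')) ;;
     Cond (Sub (Var ''n'') (Read ''D'' (Var ''w''))) Skip
       (Store ''D'' (Var ''w'') (Add (Read ''D'' (Var ''v'')) (Const 1)) ;;
        Store ''Q'' (Var ''t'') (Var ''w'') ;;
        Assign ''t'' (Add (Var ''t'') (Const 1)))"

definition scan :: com where
  "scan = Assign ''v'' (Read ''Q'' (Var ''h'')) ;;
     Assign ''i'' (Read ''off'' (Var ''v'')) ;;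
     Assign ''f'' (Read ''off'' (Add (Var ''v'') (Const 1))) ;;
     For ''i'' ''f'' visit"

definition bfs_init :: com where
  "bfs_init = Assign ''i'' (Const 0) ;;
     For ''i'' ''n'' (Store ''D'' (Var ''i'') (Var ''n'')) ;;
     Store ''D'' (Var ''r'') (Const 0) ;;
     Store ''Q'' (Const 0) (Var ''r'') ;;
     Assign ''h'' (Const 0) ;;
     Assign ''t'' (Const 1)"

definition bfs :: com where
  "bfs = bfs_init ;;
     While (Sub (Var ''t'') (Var ''h'')) (scan ;; Assign ''h'' (Add (Var ''h'') (Const 1))) ;;
     Assign ''z'' (Read ''Q'' (Sub (Var ''n'') (Const 1))) ;;
     Assign ''e'' (Read ''D'' (Var ''z''))"

lemma written_scan:
  "written_vars visit = {''w'', ''t''}" "written_arrs visit = {''D'', ''Q''}"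
  "written_vars scan = {''v'', ''i'', ''f'', ''w'', ''t''}" "written_arrs scan = {''D'', ''Q''}"
  by (auto simp: visit_def scan_def)

lemma written_bfs:
  "written_vars bfs_init = {''i'', ''h'', ''t''}" "written_arrs bfs_init = {''D'', ''Q''}"
  "written_vars bfs = {''i'', ''h'', ''t'', ''v'', ''f'', ''w'', ''z'', ''e''}"
  "written_arrs bfs = {''D'', ''Q''}"
  by (auto simp: bfs_init_def bfs_def written_scan)

text \<open>The estimates add an eccentricity and a distance, which needs \<open>2 * n\<close>;
  \<open>offset n\<close> bounds the positions in the neighbour array.\<close>

locale bounded_graph = listed_graph +
  fixes B :: nat
  assumes B: "2 * n \<le> B" "offset n \<le> B"
begin

lemma B_simps: "1 \<le> B" "Suc 0 \<le> B" "n \<le> B" "i \<le> n \<Longrightarrow> i \<le> B" "i < n \<Longrightarrow> Suc i \<le> B"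
  using B n_pos by auto

text \<open>The queue is preserved up to position \<open>h\<close> so that \<open>v\<close> remains
  the vertex being scanned and the set of scanned vertices, on which the potential of the outer loop
  depends, does not change.\<close>

lemma wp_visit:
  assumes "graph_loaded s" "bfs_inv r h (var s ''t'') (arr s ''D'') (arr s ''Q'')" "h < var s ''t''"
    "var s ''v'' = arr s ''Q'' h" "var s ''i'' = offset (var s ''v'') + j" "j < length (L (var s ''v''))"
  shows "wp B visit (\<lambda>_ s'. bfs_inv r h (var s' ''t'') (arr s' ''D'') (arr s' ''Q'') \<and> h < var s' ''t'' \<and>
    (\<forall>l\<le>h. arr s' ''Q'' l = arr s ''Q'' l) \<and>
    insert (L (var s ''v'') ! j) (arr s ''Q'' ` {..<var s ''t''}) \<subseteq> arr s' ''Q'' ` {..<var s' ''t''}) 30 s"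
proof -
  let ?v = "var s ''v''" and ?t = "var s ''t''" and ?D = "arr s ''D''" and ?Q = "arr s ''Q''"
  let ?w = "L ?v ! j"
  note D = bfs_invD[OF assms(2)]
  have v: "?v < n"
    using D(3) assms by simp
  have w: "arr s ''nbr'' (offset ?v + j) = ?w" "var s ''n'' = n"
    using assms v by (auto simp: graph_loaded_def)
  have edge: "(?Q h, ?w) \<in> adjacency E" "?w < n"
    using set_L[OF v, of ?w] set_L_less[OF v, of ?w] assms by auto
  have img: "insert ?w (?Q ` {..<?t}) \<subseteq> (?Q(?t := ?w)) ` {..<Suc ?t}"
    by (auto simp: lessThan_Suc)
  show ?thesis
  proof (cases "?w \<in> ?Q ` {..<?t}")
    case True
    then have "?D ?w = dist r ?w" "dist r ?w < n"
      using D(6)[of ?w] edge dist_less D(5) by auto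
    then show ?thesis
      using True assms w by (simp add: visit_def)
  next
    case False
    then have "?D ?w = n"
      using D(6) edge by simp
    moreover have Dv: "?D ?v = dist r ?v" "dist r ?v < n"
      using D(6)[of ?v] v assms dist_less D(5) by auto
    moreover have inv: "bfs_inv r h (Suc ?t) (?D(?w := Suc (?D ?v))) (?Q(?t := ?w))"
      using bfs_inv_visit[OF assms(2,3) edge(1) False] assms(4) by simp
    moreover have "Suc ?t \<le> n"
      using bfs_inv_queue_le[OF inv] .
    ultimately show ?thesis
      using assms w B_simps img by (simp add: visit_def)
  qed
qed

lemma wp_scan:
  assumes "graph_loaded s" "bfs_inv r (var s ''h'') (var s ''t'') (arr s ''D'') (arr s ''Q'')"
    "var s ''h'' < var s ''t''"
  shows "wp B scan (\<lambda>_ s'. bfs_inv r (Suc (var s ''h'')) (var s' ''t'') (arr s' ''D'') (arr s' ''Q'') \<and>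
    (\<forall>l\<le>var s ''h''. arr s' ''Q'' l = arr s ''Q'' l))
    (20 + 39 * length (L (arr s ''Q'' (var s ''h'')))) s"
proof -
  define h where "h = var s ''h''"
  define v where "v = arr s ''Q'' h"
  let ?s = "set_var ''f'' (offset (Suc v)) (set_var ''i'' (offset v) (set_var ''v'' v s))"
  define I :: "nat \<Rightarrow> store \<Rightarrow> bool" where "I = (\<lambda>i s'. bfs_inv r h (var s' ''t'') (arr s' ''D'') (arr s' ''Q'') \<and> h < var s' ''t'' \<and>
    (\<forall>l\<le>h. arr s' ''Q'' l = arr s ''Q'' l) \<and>
    (\<forall>j. offset v + j < i \<longrightarrow> L v ! j \<in> arr s' ''Q'' ` {..<var s' ''t''}))"
  have v: "v < n"
    using bfs_invD(3)[OF assms(2)] assms by (simp add: v_def h_def)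
  have off: "arr s ''off'' v = offset v" "arr s ''off'' (Suc v) = offset (Suc v)"
    using assms v by (auto simp: graph_loaded_def)
  have "wp B (For ''i'' ''f'' visit)
    (\<lambda>_ s'. bfs_inv r (Suc h) (var s' ''t'') (arr s' ''D'') (arr s' ''Q'') \<and>
      (\<forall>l\<le>h. arr s' ''Q'' l = arr s ''Q'' l)) (4 + 39 * length (L v)) ?s"
  proof (rule wp_For[where I = I and w = "\<lambda>_. 30" and a = "offset v" and b = "offset (Suc v)"])
    show "offset v \<le> offset (Suc v)"
      by (simp add: offset_Suc)
    show "offset (Suc v) \<le> B"
      using offset_mono[of "Suc v" n] v B by simp
    show "I (offset v) ?s"
      using assms by (simp add: I_def h_def)
    show "(\<Sum>i = offset v..<offset (Suc v). 30 + 9) + 4 \<le> 4 + 39 * length (L v)"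
      by (simp add: offset_Suc)
  next
    fix i s'
    assume s': "same_except (insert ''i'' (written_vars visit)) (written_arrs visit) ?s s'"
      "offset v \<le> i" "i < offset (Suc v)" "var s' ''i'' = i" "I i s'"
    define j where "j = i - offset v"
    have j: "i = offset v + j" "j < length (L v)"
      using s' by (auto simp: j_def offset_Suc)
    have g: "graph_loaded s'" "var s' ''v'' = v"
      using graph_loaded_same_except[OF s'(1)] same_exceptD(1)[OF s'(1), of "''v''"] assms(1)
      by (simp_all add: written_scan)
    have "wp B visit (\<lambda>_ s'a. bfs_inv r h (var s'a ''t'') (arr s'a ''D'') (arr s'a ''Q'') \<and> h < var s'a ''t'' \<and>
      (\<forall>l\<le>h. arr s'a ''Q'' l = arr s' ''Q'' l) \<and>
      insert (L (var s' ''v'') ! j) (arr s' ''Q'' ` {..<var s' ''t''}) \<subseteq> arr s'a ''Q'' ` {..<var s'a ''t''}) 30 s'"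
      using s' g j by (intro wp_visit) (auto simp: I_def v_def)
    then show "wp B visit (\<lambda>_ s''. I (Suc i) (set_var ''i'' (Suc i) s'')) 30 s'"
      by (rule wp_conseq) (use s'(5) j g in \<open>auto simp: I_def less_Suc_eq\<close>)
  next
    fix u s'
    assume s': "same_except (insert ''i'' (written_vars visit)) (written_arrs visit) ?s s'"
      "I (offset (Suc v)) s'"
    have "w \<in> arr s' ''Q'' ` {..<var s' ''t''}" if "(arr s' ''Q'' h, w) \<in> adjacency E" for w
    proof -
      have "w \<in> set (L v)"
        using that s'(2) set_L[OF v] by (auto simp: I_def v_def)
      then show ?thesis
        using s'(2) by (auto simp: I_def in_set_conv_nth offset_Suc)
    qed
    then have "bfs_inv r (Suc h) (var s' ''t'') (arr s' ''D'') (arr s' ''Q'')"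
      using s'(2) unfolding I_def by (intro bfs_inv_next) blast+
    then show "bfs_inv r (Suc h) (var s' ''t'') (arr s' ''D'') (arr s' ''Q'') \<and>
      (\<forall>l\<le>h. arr s' ''Q'' l = arr s ''Q'' l)"
      using s'(2) by (simp add: I_def)
  qed (use B_simps in \<open>auto simp: written_scan\<close>)
  then have "wp B scan (\<lambda>_ s'. bfs_inv r (Suc h) (var s' ''t'') (arr s' ''D'') (arr s' ''Q'') \<and>
    (\<forall>l\<le>h. arr s' ''Q'' l = arr s ''Q'' l)) (20 + 39 * length (L v)) s"
    unfolding scan_def using B_simps v off
    by (auto simp: h_def[symmetric] v_def[symmetric] intro: wp_conseq)
  then show ?thesis
    by (simp add: h_def v_def)
qed

text \<open>The sum of \<open>12 * n + 30\<close> for the initialization,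
  \<open>30 * n + 39 * offset n + 4\<close> for the loop and a constant for the rest.\<close>

definition bfs_cost :: nat where
  "bfs_cost = 42 * n + 39 * offset n + 60"

lemma wp_bfs_init:
  assumes "var s ''n'' = n" "var s ''r'' < n"
  shows "wp B bfs_init (\<lambda>_ s'. bfs_inv (var s ''r'') 0 1 (arr s' ''D'') (arr s' ''Q'') \<and>
    var s' ''h'' = 0 \<and> var s' ''t'' = 1) (12 * n + 30) s"
proof -
  have "wp B (For ''i'' ''n'' (Store ''D'' (Var ''i'') (Var ''n''))) (\<lambda>_ s'. \<forall>v<n. arr s' ''D'' v = n)
      (12 * n + 4) (set_var ''i'' 0 s)"
    by (rule wp_For[where I = "\<lambda>i s'. \<forall>v<i. arr s' ''D'' v = n" and w = "\<lambda>_. 3" and a = 0 and b = n])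
      (use assms B_simps in \<open>auto simp: less_Suc_eq\<close>)
  then show ?thesis
    unfolding bfs_init_def using assms(2) B_simps
    by (auto simp: same_except_def elim!: wp_conseq intro!: bfs_inv_init[unfolded One_nat_def])
qed

lemma wp_bfs_loop:
  assumes "graph_loaded s" "bfs_inv r 0 1 (arr s ''D'') (arr s ''Q'')" "var s ''h'' = 0" "var s ''t'' = 1"
  shows "wp B (While (Sub (Var ''t'') (Var ''h'')) (scan ;; Assign ''h'' (Add (Var ''h'') (Const 1))))
    (\<lambda>_ s'. \<exists>t. bfs_inv r t t (arr s' ''D'') (arr s' ''Q'')) (30 * n + 39 * offset n + 4) s"
proof (rule wp_While)
  let ?I = "\<lambda>s. bfs_inv r (var s ''h'') (var s ''t'') (arr s ''D'') (arr s ''Q'')"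
  \<comment> \<open>Every vertex not yet scanned holds credit for one scan of its list: 39 per
    neighbour and 30 for the fixed part, of which 4 pay for the loop test.\<close>
  let ?\<Phi> = "\<lambda>s. \<Sum>v\<in>{..<n} - arr s ''Q'' ` {..<var s ''h''}. 30 + 39 * length (L v)"
  let ?w = "\<lambda>s. 26 + 39 * length (L (arr s ''Q'' (var s ''h'')))"
  show "?I s"
    using assms by simp
  show "1 + exp_size (Sub (Var ''t'') (Var ''h'')) + ?\<Phi> s \<le> 30 * n + 39 * offset n + 4"
    using assms by (simp add: sum.distrib sum_distrib_left offset_def)
  fix s'
  assume same: "same_except (written_vars (scan ;; Assign ''h'' (Add (Var ''h'') (Const 1))))
      (written_arrs (scan ;; Assign ''h'' (Add (Var ''h'') (Const 1)))) s s'" and I: "?I s'"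
  show "fits B s' (Sub (Var ''t'') (Var ''h''))"
    by simp
  show "\<exists>t. bfs_inv r t t (arr s' ''D'') (arr s' ''Q'')" if "eval s' (Sub (Var ''t'') (Var ''h'')) = 0"
    using I that bfs_invD(1)[OF I] by auto
  assume "eval s' (Sub (Var ''t'') (Var ''h'')) \<noteq> 0"
  then have ht: "var s' ''h'' < var s' ''t''"
    by simp
  define h where "h = var s' ''h''"
  let ?v = "arr s' ''Q'' h"
  have g: "graph_loaded s'"
    using graph_loaded_same_except[OF same] assms(1) by (simp add: written_scan)
  have v: "?v < n" and h: "h < n"
    using bfs_invD(3)[OF I] ht bfs_inv_queue_le[OF I] by (auto simp: h_def)
  \<comment> \<open>The queue has no repetitions, so the credit of the head is still
    available.\<close>
  have new: "?v \<notin> arr s' ''Q'' ` {..<h}"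
    using bfs_invD(2)[OF I] ht by (force simp: h_def inj_on_def)
  have "wp B scan (wp B (Assign ''h'' (Add (Var ''h'') (Const 1)))
      (\<lambda>_ s''. ?I s'' \<and> ?\<Phi> s'' + ?w s' + 1 + exp_size (Sub (Var ''t'') (Var ''h'')) \<le> ?\<Phi> s'))
      (25 + 39 * length (L ?v)) s'"
  proof (rule wp_conseq[OF wp_scan[OF g I ht]])
    show "20 + 39 * length (L (arr s' ''Q'' (var s' ''h''))) \<le> 25 + 39 * length (L ?v)"
      by (simp add: h_def)
    fix u u' s''
    assume s'': "bfs_inv r (Suc (var s' ''h'')) (var s'' ''t'') (arr s'' ''D'') (arr s'' ''Q'') \<and>
        (\<forall>l\<le>var s' ''h''. arr s'' ''Q'' l = arr s' ''Q'' l)"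
      "u = u' + (25 + 39 * length (L ?v) - (20 + 39 * length (L (arr s' ''Q'' (var s' ''h'')))))"
      "same_except (written_vars scan) (written_arrs scan) s' s''"
    have h'': "var s'' ''h'' = h"
      using same_exceptD(1)[OF s''(3), of "''h''"] by (simp add: written_scan h_def)
    have "arr s'' ''Q'' ` {..<Suc h} = arr s' ''Q'' ` {..<Suc h}"
      using s''(1) by (intro image_cong) (auto simp: h_def)
    then have "{..<n} - arr s' ''Q'' ` {..<h} = insert ?v ({..<n} - arr s'' ''Q'' ` {..<Suc h})"
      "?v \<notin> {..<n} - arr s'' ''Q'' ` {..<Suc h}"
      using v new by (auto simp: lessThan_Suc)
    then have "(\<Sum>v\<in>{..<n} - arr s' ''Q'' ` {..<h}. 30 + 39 * length (L v)) =
        30 + 39 * length (L ?v) + (\<Sum>v\<in>{..<n} - arr s'' ''Q'' ` {..<Suc h}. 30 + 39 * length (L v))"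
      by simp
    then show "wp B (Assign ''h'' (Add (Var ''h'') (Const 1)))
      (\<lambda>_ s''. ?I s'' \<and> ?\<Phi> s'' + ?w s' + 1 + exp_size (Sub (Var ''t'') (Var ''h'')) \<le> ?\<Phi> s') u s''"
      using s'' h'' h B_simps by (simp add: h_def[symmetric])
  qed
  then show "wp B (scan ;; Assign ''h'' (Add (Var ''h'') (Const 1)))
      (\<lambda>_ s''. ?I s'' \<and> ?\<Phi> s'' + ?w s' + 1 + exp_size (Sub (Var ''t'') (Var ''h'')) \<le> ?\<Phi> s') (?w s') s'"
    unfolding wp_Seq h_def by simp
qed

lemma wp_bfs:
  assumes "graph_loaded s" "var s ''r'' < n"
  shows "wp B bfs (\<lambda>_ s'. (\<forall>v<n. arr s' ''D'' v = dist (var s ''r'') v) \<and> var s' ''z'' < n \<and>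
     dist (var s ''r'') (var s' ''z'') = eccentricity (var s ''r'') \<and>
     var s' ''e'' = eccentricity (var s ''r'')) bfs_cost s"
  unfolding bfs_def
proof (rule wp_SeqI[OF wp_bfs_init])
  show "var s ''n'' = n" "var s ''r'' < n"
    using assms by (simp_all add: graph_loaded_def)
  show "12 * n + 30 < bfs_cost"
    by (simp add: bfs_cost_def)
  fix u u' s1
  assume s1: "bfs_inv (var s ''r'') 0 1 (arr s1 ''D'') (arr s1 ''Q'') \<and> var s1 ''h'' = 0 \<and> var s1 ''t'' = 1"
    and u: "u = u' + (bfs_cost - 1 - (12 * n + 30))"
    and same: "same_except (written_vars bfs_init) (written_arrs bfs_init) s s1"
  have g: "graph_loaded s1"
    using graph_loaded_same_except[OF same] assms by (simp add: written_bfs)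
  show "wp B (While (Sub (Var ''t'') (Var ''h'')) (scan ;; Assign ''h'' (Add (Var ''h'') (Const 1))) ;;
     Assign ''z'' (Read ''Q'' (Sub (Var ''n'') (Const 1))) ;; Assign ''e'' (Read ''D'' (Var ''z'')))
     (\<lambda>_ s'. (\<forall>v<n. arr s' ''D'' v = dist (var s ''r'') v) \<and> var s' ''z'' < n \<and>
     dist (var s ''r'') (var s' ''z'') = eccentricity (var s ''r'') \<and>
     var s' ''e'' = eccentricity (var s ''r'')) u s1"
  proof (rule wp_SeqI[OF wp_bfs_loop[OF g]])
    show "bfs_inv (var s ''r'') 0 1 (arr s1 ''D'') (arr s1 ''Q'')" "var s1 ''h'' = 0" "var s1 ''t'' = 1"
      using s1 by auto
    show "30 * n + 39 * offset n + 4 < u"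
      using u by (simp add: bfs_cost_def)
  next
    fix w w' s2
    let ?loop = "While (Sub (Var ''t'') (Var ''h'')) (scan ;; Assign ''h'' (Add (Var ''h'') (Const 1)))"
    assume "\<exists>t. bfs_inv (var s ''r'') t t (arr s2 ''D'') (arr s2 ''Q'')"
      and w: "w = w' + (u - 1 - (30 * n + 39 * offset n + 4))"
      and same: "same_except (written_vars ?loop) (written_arrs ?loop) s1 s2"
    then obtain t where t: "bfs_inv (var s ''r'') t t (arr s2 ''D'') (arr s2 ''Q'')"
      by blast
    have "var s2 ''n'' = n"
      using graph_loaded_same_except[OF same] g by (simp add: written_scan graph_loaded_def)
    moreover have "15 \<le> w"
      using w u by (simp add: bfs_cost_def)
    ultimately show "wp B (Assign ''z'' (Read ''Q'' (Sub (Var ''n'') (Const 1))) ;;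
      Assign ''e'' (Read ''D'' (Var ''z'')))
     (\<lambda>_ s'. (\<forall>v<n. arr s' ''D'' v = dist (var s ''r'') v) \<and> var s' ''z'' < n \<and>
     dist (var s ''r'') (var s' ''z'') = eccentricity (var s ''r'') \<and>
     var s' ''e'' = eccentricity (var s ''r'')) w s2"
      using bfs_inv_final[OF t] B_simps by auto
  qed
qed

end

section \<open>The algorithm\<close>

text \<open>After a search from \<open>r\<close>, the variable \<open>e\<close> holds the eccentricity of \<open>r\<close> and \<open>z\<close> a farthest vertex.
  The least eccentricity found so far is \<open>b\<close>, attained by \<open>a\<close>; the array \<open>est\<close> contains the upper bounds
  on the eccentricities. The root of a round is \<open>c\<close>, \<open>cl\<close> contains the distances to it modulo \<open>k\<close>,
  and \<open>g\<close> is the residue of the smallest class.\<close>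

definition relax :: com where
  "relax = Assign ''l'' (Const 0) ;;
     For ''l'' ''n'' (Cond (Sub (Read ''est'' (Var ''l'')) (Add (Var ''e'') (Read ''D'' (Var ''l''))))
       (Store ''est'' (Var ''l'') (Add (Var ''e'') (Read ''D'' (Var ''l'')))) Skip)"

definition keep_best :: com where
  "keep_best = Cond (Sub (Var ''b'') (Var ''e'')) (Assign ''b'' (Var ''e'') ;; Assign ''a'' (Var ''r'')) Skip"

definition probe :: com where
  "probe = bfs ;; keep_best ;; relax"

definition reset_counts :: com where
  "reset_counts = Assign ''j'' (Const 0) ;; For ''j'' ''k'' (Store ''cnt'' (Var ''j'') (Const 0))"

text \<open>The expressions offer no remainder operation, so the residue is computed as
  \<open>D - (D div k) * k\<close>.\<close>

definition count_classes :: com where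
  "count_classes = Assign ''j'' (Const 0) ;;
     For ''j'' ''n''
       (Store ''cl'' (Var ''j'') (Sub (Read ''D'' (Var ''j''))
          (Mul (Div (Read ''D'' (Var ''j'')) (Var ''k'')) (Var ''k''))) ;;
        Store ''cnt'' (Read ''cl'' (Var ''j'')) (Add (Read ''cnt'' (Read ''cl'' (Var ''j''))) (Const 1)))"

definition smallest_class :: com where
  "smallest_class = Assign ''g'' (Const 0) ;; Assign ''j'' (Const 0) ;;
     For ''j'' ''k''
       (Cond (Sub (Read ''cnt'' (Var ''g'')) (Read ''cnt'' (Var ''j''))) (Assign ''g'' (Var ''j'')) Skip)"

definition classify :: com where
  "classify = reset_counts ;; count_classes ;; smallest_class"

text \<open>Subtraction is truncated, so the sum of the two differences is nonzero iff
  \<open>cl[j]\<close> differs from \<open>g\<close>.\<close>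

definition probe_class :: com where
  "probe_class = Assign ''j'' (Const 0) ;;
     For ''j'' ''n''
       (Cond (Add (Sub (Read ''cl'' (Var ''j'')) (Var ''g'')) (Sub (Var ''g'') (Read ''cl'' (Var ''j''))))
          Skip (Assign ''r'' (Var ''j'') ;; probe))"

text \<open>The best vertex found becomes the root of the next round. The estimates and
  \<open>b\<close> are kept, so that repeating the phase can only sharpen them.\<close>

definition phase :: com where
  "phase = Assign ''r'' (Var ''c'') ;; probe ;; classify ;; probe_class ;; Assign ''c'' (Var ''a'')"

definition init_estimates :: com where
  "init_estimates = Assign ''b'' (Var ''n'') ;; Assign ''j'' (Const 0) ;;
     For ''j'' ''n'' (Store ''est'' (Var ''j'') (Var ''n''))"

definition max_estimate :: com where
  "max_estimate = Assign ''x'' (Const 0) ;; Assign ''j'' (Const 0) ;;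
     For ''j'' ''n''
       (Cond (Sub (Read ''est'' (Var ''j'')) (Read ''est'' (Var ''x''))) (Assign ''x'' (Var ''j'')) Skip)"

definition diametral_pair_prog :: com where
  "diametral_pair_prog = init_estimates ;; phase ;; phase ;; max_estimate ;;
     Assign ''r'' (Var ''x'') ;; bfs ;; Assign ''y'' (Var ''z'')"

lemma written_probe:
  "written_vars relax = {''l''}" "written_arrs relax = {''est''}"
  "written_vars keep_best = {''a'', ''b''}" "written_arrs keep_best = {}"
  "written_vars probe = {''i'', ''h'', ''t'', ''v'', ''f'', ''w'', ''z'', ''e'', ''a'', ''b'', ''l''}"
  "written_arrs probe = {''D'', ''Q'', ''est''}"
  by (auto simp: relax_def keep_best_def probe_def written_bfs)

lemma written_phase:
  "written_vars reset_counts = {''j''}" "written_arrs reset_counts = {''cnt''}"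
  "written_vars count_classes = {''j''}" "written_arrs count_classes = {''cl'', ''cnt''}"
  "written_vars smallest_class = {''g'', ''j''}" "written_arrs smallest_class = {}"
  "written_vars classify = {''g'', ''j''}" "written_arrs classify = {''cl'', ''cnt''}"
  "written_vars probe_class =
     {''i'', ''h'', ''t'', ''v'', ''f'', ''w'', ''z'', ''e'', ''a'', ''b'', ''l'', ''j'', ''r''}"
  "written_arrs probe_class = {''D'', ''Q'', ''est''}"
  "written_vars phase =
     {''i'', ''h'', ''t'', ''v'', ''f'', ''w'', ''z'', ''e'', ''a'', ''b'', ''l'', ''j'', ''r'', ''g'', ''c''}"
  "written_arrs phase = {''D'', ''Q'', ''est'', ''cl'', ''cnt''}"
  "written_vars init_estimates = {''b'', ''j''}" "written_arrs init_estimates = {''est''}"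
  "written_vars max_estimate = {''x'', ''j''}" "written_arrs max_estimate = {}"
  by (auto simp: reset_counts_def count_classes_def smallest_class_def classify_def probe_class_def phase_def
      init_estimates_def max_estimate_def written_probe)

section \<open>Correctness and cost of a single probe\<close>

context bounded_graph
begin

text \<open>The initial value \<open>n\<close> of \<open>b\<close> exceeds every eccentricity and
  marks that no vertex has been probed yet.\<close>

definition sound :: "store \<Rightarrow> bool" where
  "sound s \<longleftrightarrow> (\<forall>v<n. eccentricity v \<le> arr s ''est'' v) \<and>
     (var s ''b'' = n \<or> var s ''a'' < n \<and> eccentricity (var s ''a'') = var s ''b'')"

text \<open>What a probe from \<open>u\<close> achieves, phrased by upper bounds so that it persists
  while \<open>b\<close> and the estimates decrease.\<close>

definition covered :: "store \<Rightarrow> nat \<Rightarrow> bool" where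
  "covered s u \<longleftrightarrow> var s ''b'' \<le> eccentricity u \<and> (\<forall>v<n. arr s ''est'' v \<le> eccentricity u + dist u v)"

lemma sound_covered_set_var [simp]:
  "x \<noteq> ''a'' \<Longrightarrow> x \<noteq> ''b'' \<Longrightarrow> sound (set_var x i s) \<longleftrightarrow> sound s"
  "x \<noteq> ''b'' \<Longrightarrow> covered (set_var x i s) = covered s"
  by (simp_all add: sound_def covered_def fun_eq_iff)

lemma sound_covered_same_except:
  assumes "same_except X A s s'" "''a'' \<notin> X" "''b'' \<notin> X" "''est'' \<notin> A"
  shows "sound s' \<longleftrightarrow> sound s" "covered s' = covered s"
  using assms by (simp_all add: same_except_def sound_def covered_def fun_eq_iff)

lemma wp_relax:
  assumes "var s ''n'' = n" "var s ''e'' \<le> n" "\<And>v. v < n \<Longrightarrow> arr s ''D'' v \<le> n"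
  shows "wp B relax (\<lambda>_ s'. \<forall>v<n. arr s' ''est'' v = min (arr s ''est'' v) (var s ''e'' + arr s ''D'' v))
    (23 * n + 10) s"
proof -
  have "wp B (For ''l'' ''n'' (Cond (Sub (Read ''est'' (Var ''l'')) (Add (Var ''e'') (Read ''D'' (Var ''l''))))
       (Store ''est'' (Var ''l'') (Add (Var ''e'') (Read ''D'' (Var ''l'')))) Skip))
     (\<lambda>_ s'. \<forall>v<n. arr s' ''est'' v = min (arr s ''est'' v) (var s ''e'' + arr s ''D'' v))
     (23 * n + 4) (set_var ''l'' 0 s)"
  proof (rule wp_For[where I = "\<lambda>i s'. \<forall>v. arr s' ''est'' v =
      (if v < i then min (arr s ''est'' v) (var s ''e'' + arr s ''D'' v) else arr s ''est'' v)"
      and w = "\<lambda>_. 14" and a = 0 and b = n], goal_cases)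
    case (11 i s')
    have "var s' ''e'' = var s ''e''" "arr s' ''D'' = arr s ''D''"
      using same_exceptD[OF 11(1)] by auto
    moreover have "var s ''e'' + arr s ''D'' i \<le> B"
      using assms(2) assms(3)[of i] 11 B by simp
    ultimately show ?case
      using 11 by (auto simp: less_Suc_eq)
  qed (use assms B_simps in auto)
  then show ?thesis
    unfolding relax_def by (auto elim!: wp_conseq)
qed

definition probe_cost :: nat where
  "probe_cost = bfs_cost + 23 * n + 30"

text \<open>The triangle inequality shows that \<open>eccentricity r + dist r v\<close> is an upper
  bound on the eccentricity of \<open>v\<close>, so taking minima preserves soundness; minima also
  preserve \<open>covered\<close>.\<close>

lemma wp_probe:
  assumes "graph_loaded s" "var s ''r'' < n" "sound s"
  shows "wp B probe (\<lambda>_ s'. sound s' \<and> covered s' (var s ''r'') \<and> (\<forall>u. covered s u \<longrightarrow> covered s' u) \<and>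
     (\<forall>v<n. arr s' ''D'' v = dist (var s ''r'') v)) probe_cost s"
  unfolding probe_def
proof (rule wp_SeqI[OF wp_bfs[OF assms(1,2)]], goal_cases)
  case 1
  then show ?case
    by (simp add: probe_cost_def)
next
  case (2 u u' s1)
  let ?r = "var s ''r''"
  \<comment> \<open>The store after \<open>keep_best\<close>.\<close>
  define s2 where "s2 = (if var s ''b'' - eccentricity ?r \<noteq> 0
    then set_var ''a'' ?r (set_var ''b'' (eccentricity ?r) s1) else s1)"
  have s1: "var s1 ''r'' = ?r" "var s1 ''a'' = var s ''a''" "var s1 ''b'' = var s ''b''"
    "arr s1 ''est'' = arr s ''est''" "graph_loaded s1"
    using same_exceptD[OF 2(3)] graph_loaded_same_except[OF 2(3)] assms(1) by (simp_all add: written_bfs)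
  have s2: "var s2 ''n'' = n" "var s2 ''e'' = eccentricity ?r" "arr s2 = arr s1"
    "var s2 ''b'' = min (var s ''b'') (eccentricity ?r)"
    "var s2 ''a'' = (if var s ''b'' - eccentricity ?r \<noteq> 0 then ?r else var s ''a'')"
    using 2(1) s1 by (auto simp: s2_def graph_loaded_def)
  have ecc: "eccentricity ?r < n" "\<And>v. v < n \<Longrightarrow> eccentricity v \<le> eccentricity ?r + dist ?r v"
    using eccentricity_less assms(2) ecc_le_add_gdist[of _ ?r] gdist_sym[of _ ?r]
    by (auto simp: add.commute)
  have "wp B relax (\<lambda>_ s'. \<forall>v<n. arr s' ''est'' v = min (arr s2 ''est'' v) (var s2 ''e'' + arr s2 ''D'' v))
    (23 * n + 10) s2"
    using s2 2(1) ecc dist_less[OF assms(2)] by (intro wp_relax) (auto intro: less_imp_le)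
  then have "wp B relax (\<lambda>_ s'. sound s' \<and> covered s' ?r \<and> (\<forall>u. covered s u \<longrightarrow> covered s' u) \<and>
      (\<forall>v<n. arr s' ''D'' v = dist ?r v)) (23 * n + 15) s2"
  proof (rule wp_conseq, goal_cases)
    case 1
    then show ?case
      by simp
  next
    case (2 w w' s3)
    have s3: "var s3 ''a'' = var s2 ''a''" "var s3 ''b'' = var s2 ''b''" "arr s3 ''D'' = arr s2 ''D''"
      using same_exceptD[OF 2(3)] by (simp_all add: written_probe)
    have D: "\<And>v. v < n \<Longrightarrow> arr s3 ''D'' v = dist ?r v"
      using s3 s2 \<open>(\<forall>v<n. arr s1 ''D'' v = _ v) \<and> _\<close> by simp
    have est: "\<And>v. v < n \<Longrightarrow> arr s3 ''est'' v = min (arr s ''est'' v) (eccentricity ?r + dist ?r v)"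
      using 2(1) D s3 s2 s1 by simp
    have "sound s3"
      using assms(2,3) ecc est s3 s2 by (auto simp: sound_def min_def)
    moreover have "covered s3 ?r" "\<forall>u. covered s u \<longrightarrow> covered s3 u"
      using est s3 s2 by (auto simp: covered_def min.coboundedI1)
    ultimately show ?case
      using D by simp
  qed
  then show ?case
    using 2(1,2) s1 by (auto simp: keep_best_def s2_def probe_cost_def elim!: wp_conseq)
qed

end

text \<open>Averaging: the \<open>k\<close> classes partition the \<open>n\<close> vertices, so
  \<open>k\<close> times the smallest size is at most \<open>n\<close>.\<close>

lemma smallest_residue_class:
  fixes f :: "nat \<Rightarrow> nat"
  assumes "0 < k"
    and "\<And>q. q < k \<Longrightarrow> card {v. v < n \<and> f v mod k = g} \<le> card {v. v < n \<and> f v mod k = q}"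
  shows "card {v. v < n \<and> f v mod k = g} \<le> n div k"
proof -
  have "card {v. v < n \<and> f v mod k = g} * k = (\<Sum>q<k. card {v. v < n \<and> f v mod k = g})"
    by simp
  also have "\<dots> \<le> (\<Sum>q<k. card {v \<in> {..<n}. f v mod k = q})"
    using assms(2) by (intro sum_mono) simp
  also have "\<dots> = card {..<n}"
  proof -
    have "(\<lambda>v. f v mod k) ` {..<n} \<subseteq> {..<k}"
      using assms(1) by auto
    from sum.group[OF _ _ this, of "\<lambda>_. 1::nat"] show ?thesis
      by simp
  qed
  finally show ?thesis
    using assms(1) by (simp add: less_eq_div_iff_mult_less_eq)
qed

section \<open>Residue classes of levels and one round of probes\<close>

locale level_graph = bounded_graph +
  fixes k :: nat
  assumes k: "0 < k" "k \<le> n"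
begin

lemma wp_reset_counts:
  assumes "var s ''k'' = k"
  shows "wp B reset_counts (\<lambda>_ s'. \<forall>q<k. arr s' ''cnt'' q = 0) (12 * n + 10) s"
proof -
  have "wp B (For ''j'' ''k'' (Store ''cnt'' (Var ''j'') (Const 0)))
      (\<lambda>_ s'. \<forall>q<k. arr s' ''cnt'' q = 0) (12 * n + 4) (set_var ''j'' 0 s)"
    by (rule wp_For[where I = "\<lambda>i s'. \<forall>q<i. arr s' ''cnt'' q = 0" and w = "\<lambda>_. 3" and a = 0 and b = k])
      (use assms B_simps k in \<open>auto simp: less_Suc_eq\<close>)
  then show ?thesis
    unfolding reset_counts_def by (auto elim!: wp_conseq)
qed

lemma wp_count_classes:
  assumes "var s ''n'' = n" "var s ''k'' = k" "\<And>v. v < n \<Longrightarrow> arr s ''D'' v < n"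
    "\<And>q. q < k \<Longrightarrow> arr s ''cnt'' q = 0"
  shows "wp B count_classes (\<lambda>_ s'. (\<forall>v<n. arr s' ''cl'' v = arr s ''D'' v mod k) \<and>
    (\<forall>q<k. arr s' ''cnt'' q = card {v. v < n \<and> arr s ''D'' v mod k = q})) (29 * n + 10) s"
proof -
  define I :: "nat \<Rightarrow> store \<Rightarrow> bool" where
    "I = (\<lambda>i s'. (\<forall>v<i. arr s' ''cl'' v = arr s ''D'' v mod k) \<and>
      (\<forall>q<k. arr s' ''cnt'' q = card {v. v < i \<and> arr s ''D'' v mod k = q}))"
  have "wp B (For ''j'' ''n''
       (Store ''cl'' (Var ''j'') (Sub (Read ''D'' (Var ''j''))
          (Mul (Div (Read ''D'' (Var ''j'')) (Var ''k'')) (Var ''k''))) ;;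
        Store ''cnt'' (Read ''cl'' (Var ''j'')) (Add (Read ''cnt'' (Read ''cl'' (Var ''j''))) (Const 1))))
     (\<lambda>_. I n) (29 * n + 4) (set_var ''j'' 0 s)"
  proof (rule wp_For[where I = I and w = "\<lambda>_. 20" and a = 0 and b = n], goal_cases)
    case (11 i s')
    let ?d = "arr s ''D'' i"
    have same: "var s' ''k'' = k" "arr s' ''D'' = arr s ''D''"
      using same_exceptD[OF 11(1)] assms(2) by auto
    have "?d div k * k \<le> B"
      using div_times_less_eq_dividend[of ?d k] assms(3)[of i] 11 B_simps by (meson le_trans less_imp_le)
    moreover have "?d - ?d div k * k = ?d mod k" "?d mod k < k"
      using k by (auto simp: minus_div_mult_eq_mod)
    \<comment> \<open>The counter is at most the number \<open>i < n\<close> of vertices counted so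
      far, so its increment does not exceed \<open>B\<close>.\<close>
    moreover have "Suc (arr s' ''cnt'' (?d mod k)) \<le> B"
    proof -
      have "card {v. v < i \<and> ?d mod k = arr s ''D'' v mod k} \<le> card {..<i}"
        by (intro card_mono) auto
      then show ?thesis
        using 11 k B_simps by (auto simp: I_def eq_commute)
    qed
    moreover have "card {v. v < Suc i \<and> arr s ''D'' v mod k = q} =
        (if q = ?d mod k then Suc (card {v. v < i \<and> arr s ''D'' v mod k = q})
         else card {v. v < i \<and> arr s ''D'' v mod k = q})" for q
    proof -
      have "{v. v < Suc i \<and> arr s ''D'' v mod k = q} =
          (if q = ?d mod k then insert i {v. v < i \<and> arr s ''D'' v mod k = q}
           else {v. v < i \<and> arr s ''D'' v mod k = q})"
        by (auto simp: less_Suc_eq)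
      then show ?thesis
        by simp
    qed
    ultimately show ?case
      using 11 same B_simps by (auto simp: I_def less_Suc_eq)
  qed (use assms B_simps in \<open>auto simp: I_def\<close>)
  then show ?thesis
    unfolding count_classes_def I_def by (auto elim!: wp_conseq)
qed

lemma wp_smallest_class:
  assumes "var s ''k'' = k"
  shows "wp B smallest_class (\<lambda>_ s'. var s' ''g'' < k \<and>
    (\<forall>q<k. arr s ''cnt'' (var s' ''g'') \<le> arr s ''cnt'' q)) (17 * n + 15) s"
proof -
  have "wp B (For ''j'' ''k''
       (Cond (Sub (Read ''cnt'' (Var ''g'')) (Read ''cnt'' (Var ''j''))) (Assign ''g'' (Var ''j'')) Skip))
     (\<lambda>_ s'. var s' ''g'' < k \<and> (\<forall>q<k. arr s ''cnt'' (var s' ''g'') \<le> arr s ''cnt'' q))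
     (17 * n + 4) (set_var ''j'' 0 (set_var ''g'' 0 s))"
  proof (rule wp_For[where I = "\<lambda>i s'. var s' ''g'' < k \<and>
      (\<forall>q<i. arr s ''cnt'' (var s' ''g'') \<le> arr s ''cnt'' q)" and w = "\<lambda>_. 8" and a = 0 and b = k], goal_cases)
    case (11 i s')
    have "arr s' ''cnt'' = arr s ''cnt''"
      using same_exceptD[OF 11(1)] by auto
    then show ?case
      using 11 by (auto simp: less_Suc_eq intro: less_imp_le le_trans)
  qed (use assms B_simps k in auto)
  then show ?thesis
    unfolding smallest_class_def using B_simps by (auto elim!: wp_conseq)
qed

lemma wp_classify:
  assumes "var s ''n'' = n" "var s ''k'' = k" "\<And>v. v < n \<Longrightarrow> arr s ''D'' v < n"
  shows "wp B classify (\<lambda>_ s'. var s' ''g'' < k \<and> (\<forall>v<n. arr s' ''cl'' v = arr s ''D'' v mod k) \<and>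
    card {v. v < n \<and> arr s ''D'' v mod k = var s' ''g''} \<le> n div k) (58 * n + 40) s"
  unfolding classify_def
proof (rule wp_SeqI[OF wp_reset_counts[OF assms(2)]], goal_cases)
  case (2 u1 u1' s1)
  have s1: "var s1 ''n'' = n" "var s1 ''k'' = k" "arr s1 ''D'' = arr s ''D''"
    using same_exceptD[OF 2(3)] assms(1,2) by (simp_all add: written_phase)
  show ?case
  proof (rule wp_SeqI[OF wp_count_classes[OF s1(1,2)]], goal_cases)
    case 1
    then show ?case
      using s1 assms(3) by simp
  next
    case 2
    then show ?case
      using \<open>\<forall>q<k. arr s1 ''cnt'' q = 0\<close> by blast
  next
    case 3
    then show ?case
      using \<open>u1 = _\<close> by simp
  next
    case (4 u2 u2' s2)
    have s2: "var s2 ''k'' = k"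
      using same_exceptD[OF 4(3)] s1 by (simp add: written_phase)
    show ?case
    proof (rule wp_conseq[OF wp_smallest_class[OF s2]], goal_cases)
      case 1
      then show ?case
        using \<open>u1 = _\<close> \<open>u2 = _\<close> by simp
    next
      case (2 u3 u3' s3)
      have "arr s3 ''cl'' = arr s2 ''cl''"
        using same_exceptD[OF 2(3)] by (simp add: written_phase)
      moreover have "card {v. v < n \<and> arr s ''D'' v mod k = var s3 ''g''} \<le>
          card {v. v < n \<and> arr s ''D'' v mod k = q}" if "q < k" for q
      proof -
        have "arr s2 ''cnt'' (var s3 ''g'') \<le> arr s2 ''cnt'' q"
          using 2(1) that by blast
        then show ?thesis
          using 2(1) 4(1) s1(3) that by simp
      qed
      ultimately show ?case
        using 2(1) 4(1) s1 smallest_residue_class[OF k(1)] by simp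
    qed
  qed
qed simp

lemma wp_probe_class:
  assumes "graph_loaded s" "sound s" "var s ''g'' < k" "\<And>v. v < n \<Longrightarrow> arr s ''cl'' v < k"
  shows "wp B probe_class (\<lambda>_ s'. sound s' \<and> (\<forall>u. covered s u \<longrightarrow> covered s' u) \<and>
    (\<forall>u<n. arr s ''cl'' u = var s ''g'' \<longrightarrow> covered s' u))
    (card {v. v < n \<and> arr s ''cl'' v = var s ''g''} * probe_cost + 24 * n + 10) s"
proof -
  define I :: "nat \<Rightarrow> store \<Rightarrow> bool" where
    "I = (\<lambda>i s'. sound s' \<and> (\<forall>u. covered s u \<longrightarrow> covered s' u) \<and>
      (\<forall>u<i. arr s ''cl'' u = var s ''g'' \<longrightarrow> covered s' u))"
  \<comment> \<open>Only members of the class pay for a probe; a worst-case bound per iteration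
    would charge \<open>n\<close> probes.\<close>
  let ?w = "\<lambda>v. (if arr s ''cl'' v = var s ''g'' then probe_cost else 0) + 15"
  have cost: "(\<Sum>v = 0..<n. ?w v + 9) = card {v. v < n \<and> arr s ''cl'' v = var s ''g''} * probe_cost + 24 * n"
  proof -
    have "(\<Sum>v = 0..<n. ?w v + 9) =
        (\<Sum>v\<in>{0..<n}. if arr s ''cl'' v = var s ''g'' then probe_cost else 0) + 24 * n"
      by (simp add: sum.distrib)
    also have "(\<Sum>v\<in>{0..<n}. if arr s ''cl'' v = var s ''g'' then probe_cost else 0) =
        (\<Sum>v\<in>{v \<in> {0..<n}. arr s ''cl'' v = var s ''g''}. probe_cost)"
      by (rule sum.inter_filter[symmetric]) simp
    finally show ?thesis
      by simp
  qed
  have "wp B (For ''j'' ''n''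
       (Cond (Add (Sub (Read ''cl'' (Var ''j'')) (Var ''g'')) (Sub (Var ''g'') (Read ''cl'' (Var ''j''))))
          Skip (Assign ''r'' (Var ''j'') ;; probe))) (\<lambda>_. I n)
     (card {v. v < n \<and> arr s ''cl'' v = var s ''g''} * probe_cost + 24 * n + 4) (set_var ''j'' 0 s)"
  proof (rule wp_For[where I = I and w = ?w and a = 0 and b = n], goal_cases)
    case (11 i s')
    have same: "var s' ''g'' = var s ''g''" "arr s' ''cl'' = arr s ''cl''"
      using same_exceptD[OF 11(1)] by (auto simp: written_probe)
    have g: "graph_loaded s'"
      using graph_loaded_same_except[OF 11(1)] assms(1) by (simp add: written_probe)
    have fit: "arr s ''cl'' i - var s ''g'' + (var s ''g'' - arr s ''cl'' i) \<le> B"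
      using assms(3) assms(4)[of i] 11 k B_simps(3) by simp
    show ?case
    proof (cases "arr s ''cl'' i = var s ''g''")
      case True
      have "wp B probe (\<lambda>_ s''. sound s'' \<and> covered s'' i \<and> (\<forall>u. covered s' u \<longrightarrow> covered s'' u))
          probe_cost (set_var ''r'' i s')"
        using wp_probe[of "set_var ''r'' i s'"] g 11 by (auto simp: I_def elim!: wp_conseq)
      then have "wp B probe (\<lambda>_ s''. I (Suc i) s'') probe_cost (set_var ''r'' i s')"
        using 11 by (auto simp: I_def less_Suc_eq elim!: wp_conseq)
      then have "wp B probe (\<lambda>_ s''. I (Suc i) (set_var ''j'' (Suc i) s'')) (probe_cost + 1) (set_var ''r'' i s')"
        by (rule wp_conseq) (auto simp: I_def)
      then show ?thesis
        using True fit 11 same by (auto elim!: wp_conseq)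
    next
      case False
      then show ?thesis
        using fit 11 same by (auto simp: I_def less_Suc_eq)
    qed
  qed (use assms B_simps cost in \<open>auto simp: I_def written_probe graph_loaded_def\<close>)
  then show ?thesis
    unfolding probe_class_def I_def by (auto elim!: wp_conseq)
qed

text \<open>One probe for the root and at most \<open>n div k\<close> for the class;
  \<open>82 * n\<close> is \<open>58 * n\<close> for \<open>classify\<close> plus
  \<open>24 * n\<close> for the loop of \<open>probe_class\<close>.\<close>

definition phase_cost :: nat where
  "phase_cost = (1 + n div k) * probe_cost + 82 * n + 70"

lemma wp_phase:
  assumes "graph_loaded s" "var s ''k'' = k" "sound s" "var s ''c'' < n"
  shows "wp B phase (\<lambda>_ s'. sound s' \<and> var s' ''c'' < n \<and>
     (\<forall>u<n. covered s' u \<longrightarrow> eccentricity (var s' ''c'') \<le> eccentricity u) \<and>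
     (\<exists>g<k. \<forall>u\<in>hitting_set k (var s ''c'') g. covered s' u)) phase_cost s"
  unfolding phase_def
proof (rule wp_SeqI[of _ _ "\<lambda>_ s'. s' = set_var ''r'' (var s ''c'') s" 2], goal_cases)
  case (3 u1 u1' s1)
  let ?c = "var s ''c''"
  have s1: "graph_loaded s1" "var s1 ''r'' = ?c" "var s1 ''k'' = k" "sound s1"
    using 3 assms by auto
  have u1: "u1 \<ge> phase_cost - 3"
    using 3 by simp
  show ?case
  proof (rule wp_SeqI[OF wp_probe[OF s1(1)]], goal_cases)
    case (4 u2 u2' s2)
    have s2: "graph_loaded s2" "var s2 ''n'' = n" "var s2 ''k'' = k"
      using graph_loaded_same_except[OF 4(3)] same_exceptD[OF 4(3)] s1
      by (auto simp: written_probe graph_loaded_def)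
    have D2: "\<And>v. v < n \<Longrightarrow> arr s2 ''D'' v = dist ?c v"
      using 4(1) s1 by simp
    have u2: "u2 \<ge> phase_cost - probe_cost - 4"
      using u1 4(2) by simp
    show ?case
    proof (rule wp_SeqI[OF wp_classify[OF s2(2,3)]], goal_cases)
      case (3 u3 u3' s3)
      have s3: "graph_loaded s3" "sound s3" "covered s3 = covered s2"
        using graph_loaded_same_except[OF 3(3)] sound_covered_same_except[OF 3(3)] s2 4(1)
        by (auto simp: written_phase)
      have cl: "\<And>v. v < n \<Longrightarrow> arr s3 ''cl'' v = dist ?c v mod k"
        using 3(1) D2 by simp
      define N where "N = card {v. v < n \<and> arr s3 ''cl'' v = var s3 ''g''}"
      have "{v. v < n \<and> arr s3 ''cl'' v = var s3 ''g''} = {v. v < n \<and> arr s2 ''D'' v mod k = var s3 ''g''}"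
        using 3(1) by auto
      then have "N * probe_cost \<le> (n div k) * probe_cost"
        using 3(1) by (simp add: N_def)
      then have u3: "N * probe_cost + 24 * n + 10 + 10 \<le> u3"
        using u2 3(2) unfolding phase_cost_def add_mult_distrib by linarith
      show ?case
      proof (rule wp_SeqI[OF wp_probe_class[OF s3(1,2)]], goal_cases)
        case (4 u4 u4' s4)
        have hit: "covered s4 u" if "u \<in> hitting_set k ?c (var s3 ''g'')" for u
          using that 4(1) cl s3 \<open>sound s2 \<and> _\<close> s1 by (auto simp: hitting_set_def)
        then have "covered s4 ?c"
          by (simp add: hitting_set_def)
        \<comment> \<open>The root has been probed, so \<open>b\<close> is below its initial value
          \<open>n\<close>, and soundness guarantees that \<open>a\<close> is a vertex attaining
          \<open>b\<close>.\<close>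
        then have "var s4 ''b'' \<le> eccentricity ?c"
          by (simp add: covered_def)
        then have "var s4 ''b'' \<noteq> n"
          using eccentricity_less[OF assms(4)] by simp
        then have "var s4 ''a'' < n" "eccentricity (var s4 ''a'') = var s4 ''b''"
          using 4(1) by (auto simp: sound_def)
        moreover have "2 \<le> u4"
          using 4(2) u3 by (simp add: N_def)
        ultimately show ?case
          using 4(1) hit 3(1) by (auto simp: covered_def)
      qed (use 3(1) cl k u3 in \<open>auto simp: N_def\<close>)
    qed (use D2 u2 dist_less[OF assms(4)] in \<open>auto simp: phase_cost_def\<close>)
  qed (use s1 assms u1 in \<open>auto simp: phase_cost_def\<close>)
qed (simp_all add: phase_cost_def)

end

section \<open>Correctness and cost of the whole algorithm\<close>

locale helly_levels = helly "{..<n}" E + level_graph n E L B k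
  for n :: nat and E :: "nat set set" and L B k +
  assumes rad: "3 * k < rad {..<n} E"
begin

lemma wp_init_estimates:
  assumes "var s ''n'' = n"
  shows "wp B init_estimates (\<lambda>_ s'. sound s') (12 * n + 15) s"
proof -
  have "wp B (For ''j'' ''n'' (Store ''est'' (Var ''j'') (Var ''n'')))
      (\<lambda>_ s'. \<forall>v<n. arr s' ''est'' v = n) (12 * n + 4) (set_var ''j'' 0 (set_var ''b'' n s))"
    by (rule wp_For[where I = "\<lambda>i s'. \<forall>v<i. arr s' ''est'' v = n" and w = "\<lambda>_. 3" and a = 0 and b = n])
      (use assms B_simps in \<open>auto simp: less_Suc_eq\<close>)
  then have "wp B (For ''j'' ''n'' (Store ''est'' (Var ''j'') (Var ''n'')))
      (\<lambda>_. sound) (12 * n + 4) (set_var ''j'' 0 (set_var ''b'' n s))"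
    by (rule wp_conseq) (use eccentricity_less in \<open>auto simp: sound_def same_except_def less_imp_le\<close>)
  then show ?thesis
    unfolding init_estimates_def using assms by (auto elim!: wp_conseq)
qed

lemma wp_max_estimate:
  assumes "var s ''n'' = n"
  shows "wp B max_estimate (\<lambda>_ s'. var s' ''x'' < n \<and>
    (\<forall>v<n. arr s ''est'' v \<le> arr s ''est'' (var s' ''x''))) (17 * n + 15) s"
proof -
  have "wp B (For ''j'' ''n''
       (Cond (Sub (Read ''est'' (Var ''j'')) (Read ''est'' (Var ''x''))) (Assign ''x'' (Var ''j'')) Skip))
     (\<lambda>_ s'. var s' ''x'' < n \<and> (\<forall>v<n. arr s ''est'' v \<le> arr s ''est'' (var s' ''x'')))
     (17 * n + 4) (set_var ''j'' 0 (set_var ''x'' 0 s))"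
  proof (rule wp_For[where I = "\<lambda>i s'. var s' ''x'' < n \<and>
      (\<forall>v<i. arr s ''est'' v \<le> arr s ''est'' (var s' ''x''))" and w = "\<lambda>_. 8" and a = 0 and b = n], goal_cases)
    case (11 i s')
    have "arr s' ''est'' = arr s ''est''"
      using same_exceptD[OF 11(1)] by auto
    then show ?case
      using 11 by (auto simp: less_Suc_eq intro: less_imp_le le_trans)
  qed (use assms B_simps n_pos in auto)
  then show ?thesis
    unfolding max_estimate_def using B_simps by (auto elim!: wp_conseq)
qed

definition total_cost :: nat where
  "total_cost = 2 * phase_cost + bfs_cost + 29 * n + 60"

text \<open>The program never initializes \<open>c\<close>; its value 0 in the input store makes
  vertex 0 the root of the first round. The final search turns a vertex \<open>x\<close> of maximum
  eccentricity into a diametral pair.\<close>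

lemma wp_diametral_pair_prog:
  assumes "graph_loaded s" "var s ''k'' = k" "var s ''c'' = 0"
  shows "wp B diametral_pair_prog (\<lambda>_ s'. diametral_pair {..<n} E (var s' ''x'') (var s' ''y''))
    total_cost s"
  unfolding diametral_pair_prog_def
proof (rule wp_SeqI[OF wp_init_estimates], goal_cases)
  case 1
  then show ?case
    using assms by (simp add: graph_loaded_def)
next
  case 2
  then show ?case
    by (simp add: total_cost_def)
next
  case (3 u1 u1' s1)
  have s1: "graph_loaded s1" "var s1 ''k'' = k" "var s1 ''c'' < n"
    using graph_loaded_same_except[OF 3(3)] same_exceptD[OF 3(3)] assms n_pos
    by (auto simp: written_phase)
  have u1: "2 * phase_cost + bfs_cost + 17 * n + 40 \<le> u1"
    using 3(2) by (simp add: total_cost_def)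
  show ?case
  proof (rule wp_SeqI[OF wp_phase[OF s1(1,2) 3(1) s1(3)]], goal_cases)
    case (2 u2 u2' s2)
    have s2: "graph_loaded s2" "var s2 ''k'' = k" "sound s2" "var s2 ''c'' < n"
      using graph_loaded_same_except[OF 2(3)] same_exceptD[OF 2(3)] s1 2(1) by (auto simp: written_phase)
    let ?c = "var s2 ''c''"
    obtain g where g: "g < k" "\<And>u. u \<in> hitting_set k (var s1 ''c'') g \<Longrightarrow> covered s2 u"
      using 2(1) by blast
    \<comment> \<open>A center \<open>z\<close> has a vertex \<open>u\<close> of the first hitting
      set at distance less than \<open>k\<close>, so \<open>u\<close> has eccentricity less than
      \<open>rad + k\<close>; the new root is at least as good as every covered vertex.\<close>
    have root: "eccentricity ?c \<le> rad {..<n} E + k"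
    proof -
      obtain z where z: "z \<in> {..<n}" "eccentricity z = rad {..<n} E"
        by (rule rad_attained)
      obtain u where u: "u \<in> {..<n}" "u \<in> hitting_set k (var s1 ''c'') g" "dist z u < k"
        using hitting_set_dominates[OF _ z(1) g(1)] s1(3) by (metis lessThan_iff)
      have "eccentricity ?c \<le> eccentricity u"
        using 2(1) g(2)[OF u(2)] u(1) by simp
      also have "\<dots> \<le> dist u z + eccentricity z"
        using ecc_le_add_gdist u z by blast
      finally show ?thesis
        using u z gdist_sym[of u z] by simp
    qed
    have u2: "phase_cost + bfs_cost + 17 * n + 39 \<le> u2"
      using 2(2) u1 by simp
    show ?case
    proof (rule wp_SeqI[OF wp_phase[OF s2]], goal_cases)
      case (2 u3 u3' s3)
      have s3: "graph_loaded s3" "var s3 ''n'' = n"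
        using graph_loaded_same_except[OF 2(3)] s2 by (auto simp: written_phase graph_loaded_def)
      obtain g where g: "g < k" "\<And>u. u \<in> hitting_set k ?c g \<Longrightarrow> covered s3 u"
        using 2(1) by blast
      have u3: "bfs_cost + 17 * n + 38 \<le> u3"
        using 2(2) u2 by simp
      have sound3: "sound s3"
        using 2(1) by blast
      show ?case
      proof (rule wp_SeqI[OF wp_max_estimate[OF s3(2)]], goal_cases)
        case (2 u4 u4' s4)
        \<comment> \<open>The array \<open>est\<close> serves as \<open>f\<close>:
          \<open>sound\<close> gives the lower bound and \<open>covered\<close> the upper
          bound.\<close>
        have "eccentricity (var s4 ''x'') = diam {..<n} E"
          using 2(1) g s2(4) rad root sound3
          by (intro maximal_estimate_is_peripheral[of ?c g k "arr s3 ''est''"])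
            (auto simp: sound_def covered_def)
        moreover have "graph_loaded (set_var ''r'' (var s4 ''x'') s4)"
          using graph_loaded_same_except[OF 2(3)] s3(1) by (simp add: written_phase)
        moreover have "bfs_cost + 20 \<le> u4"
          using 2(2) u3 by simp
        ultimately show ?case
          using 2(1) wp_bfs[of "set_var ''r'' (var s4 ''x'') s4"]
          by (auto simp: diametral_pair_def same_except_def written_bfs elim!: wp_conseq)
      qed (use u3 in auto)
    qed (use u2 in auto)
  qed (use u1 in auto)
qed

end

section \<open>Input and running time\<close>

lemma nth_concat_upt:
  assumes "v < n" "j < length (L v)"
  shows "(\<Sum>u<v. length (L u)) + j < length (concat (map L [0..<n])) \<and>
    concat (map L [0..<n]) ! ((\<Sum>u<v. length (L u)) + j) = L v ! j"
  using assms
proof (induction n)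
  case (Suc n)
  have len: "length (concat (map L [0..<n])) = (\<Sum>u<n. length (L u))"
    by (simp add: length_concat interv_sum_list_conv_sum_set_nat atLeast0LessThan o_def)
  show ?case
  proof (cases "v < n")
    case True
    then show ?thesis
      using Suc by (simp add: nth_append)
  next
    case False
    then show ?thesis
      using Suc.prems len by (simp add: nth_append less_Suc_eq)
  qed
qed simp

section \<open>Edge counts and the input store\<close>

context listed_graph
begin

lemma finite_E: "finite E"
  using simple finite_V by (auto simp: simple_graph_def intro: finite_subset[of E "Pow {..<n}"])

lemma length_L: "v < n \<Longrightarrow> length (L v) = card {u. {v, u} \<in> E}"
  using adj_lists distinct_card[of "L v"] by (simp add: adj_lists_def)

lemma card_neighbours: "card {u. {v, u} \<in> E} = card {e \<in> E. v \<in> e}"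
proof (rule bij_betw_same_card[of "\<lambda>u. {v, u}"])
  show "bij_betw (\<lambda>u. {v, u}) {u. {v, u} \<in> E} {e \<in> E. v \<in> e}"
    unfolding bij_betw_def
  proof
    show "inj_on (\<lambda>u. {v, u}) {u. {v, u} \<in> E}"
      by (auto simp: inj_on_def doubleton_eq_iff)
    show "(\<lambda>u. {v, u}) ` {u. {v, u} \<in> E} = {e \<in> E. v \<in> e}"
    proof (intro equalityI subsetI)
      fix e assume e: "e \<in> {e \<in> E. v \<in> e}"
      then have "card e = 2"
        using simple by (auto simp: simple_graph_def)
      then obtain x y where "e = {x, y}"
        by (auto simp: card_2_iff)
      then have "e = {v, if v = x then y else x}"
        using e by auto
      then show "e \<in> (\<lambda>u. {v, u}) ` {u. {v, u} \<in> E}"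
        using e by auto
    qed auto
  qed
qed

text \<open>The handshake lemma, by double counting the incidences of vertices and edges.\<close>

lemma offset_eq_edges: "offset n = 2 * card E"
proof -
  have "offset n = (\<Sum>v<n. \<Sum>e\<in>{e \<in> E. v \<in> e}. 1)"
    unfolding offset_def by (intro sum.cong) (auto simp: length_L card_neighbours)
  also have "\<dots> = (\<Sum>e\<in>E. \<Sum>v\<in>{v \<in> {..<n}. v \<in> e}. 1)"
    using finite_E by (intro sum.swap_restrict) auto
  also have "\<dots> = (\<Sum>e\<in>E. 2)"
  proof (intro sum.cong)
    fix e assume "e \<in> E"
    then have "e \<subseteq> {..<n}" "card e = 2"
      using simple by (auto simp: simple_graph_def)
    moreover from this have "{v \<in> {..<n}. v \<in> e} = e"
      by auto
    ultimately show "(\<Sum>v\<in>{v \<in> {..<n}. v \<in> e}. 1) = (2::nat)"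
      by simp
  qed simp
  finally show ?thesis
    by simp
qed

lemma offset_le_square: "offset n \<le> n * n"
proof -
  have "length (L v) \<le> n" if "v < n" for v
    using distinct_card[of "L v"] adj_lists card_mono[of "{..<n}" "set (L v)"] set_L_less that
    by (auto simp: adj_lists_def subset_iff)
  then show ?thesis
    unfolding offset_def using sum_bounded_above[of "{..<n}" "\<lambda>v. length (L v)" n] by simp
qed

text \<open>By connectivity every degree is positive. The bound absorbs costs linear in
  \<open>n\<close> into multiples of the number of edges.\<close>

lemma vertices_le_edges:
  assumes "1 < n"
  shows "n \<le> 2 * card E"
proof -
  have "1 \<le> length (L v)" if v: "v < n" for v
  proof -
    define w where "w = (if v = 0 then 1 else 0 :: nat)"
    have w: "w < n" "v \<noteq> w"
      using assms by (auto simp: w_def)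
    then obtain l where "dist v w = Suc l"
      using gdist_eq_0[of v w] v w by (cases "dist v w") auto
    then obtain u where "(v, u) \<in> adjacency E"
      using gdist_SucE[of v w l] w v by (metis lessThan_iff)
    then have "u \<in> set (L v)"
      using set_L v by blast
    then show ?thesis
      by (cases "L v") auto
  qed
  then have "(\<Sum>v<n. 1) \<le> offset n"
    unfolding offset_def by (intro sum_mono) auto
  then show ?thesis
    using offset_eq_edges by simp
qed

lemma graph_loaded_input: "graph_loaded (graph_input n m L k)"
proof -
  have "array_of (map (\<lambda>v. \<Sum>u<v. length (L u)) [0..<Suc n]) v = offset v" if "v \<le> n" for v
    using that by (auto simp: array_of_def offset_def nth_append)
  moreover have "array_of (concat (map L [0..<n])) (offset v + j) = L v ! j"
    if "v < n" "j < length (L v)" for v j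
    using nth_concat_upt[of v n j L] that by (simp add: array_of_def offset_def)
  ultimately show ?thesis
    by (simp add: graph_loaded_def graph_input_def)
qed

lemma bounded_store_input:
  assumes "n \<le> B" "m \<le> B" "k \<le> B" "offset n \<le> B"
  shows "bounded_store B (graph_input n m L k)"
proof -
  have "array_of (map (\<lambda>v. \<Sum>u<v. length (L u)) [0..<Suc n]) v \<le> B" for v
  proof (cases "v \<le> n")
    case True
    then have "offset v \<le> B"
      using offset_mono assms(4) le_trans by blast
    then show ?thesis
      using True by (auto simp: array_of_def offset_def nth_append)
  qed (simp add: array_of_def)
  moreover have "array_of (concat (map L [0..<n])) i \<le> B" for i
  proof (cases "i < length (concat (map L [0..<n]))")
    case True
    then have "concat (map L [0..<n]) ! i \<in> set (concat (map L [0..<n]))"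
      using nth_mem by blast
    then have "concat (map L [0..<n]) ! i < n"
      using set_L_less by auto
    then show ?thesis
      using True assms(1) by (simp add: array_of_def)
  qed (simp add: array_of_def)
  ultimately show ?thesis
    using assms by (auto simp: bounded_store_def graph_input_def)
qed

end

text \<open>\<open>B\<close> is at most \<open>n ^ 3\<close>, whose value cost is at most
  \<open>2 + 3 * log 2 n\<close>, and the constant 2 is at most \<open>2 * log 2 n\<close>.\<close>

lemma value_cost_le_log:
  assumes "2 \<le> n" "B \<le> 2 * n + n * n"
  shows "real (value_cost B) \<le> 5 * log 2 (real n)"
proof -
  have "B \<le> n ^ 3"
  proof -
    have "2 * n + n * n \<le> n * n + n * n"
      using assms(1) by simp
    also have "\<dots> = 2 * (n * n)"
      by simp
    also have "\<dots> \<le> n * (n * n)"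
      using assms(1) by (intro mult_right_mono) auto
    finally show ?thesis
      using assms(2) by (simp add: power3_eq_cube mult.assoc)
  qed
  have n: "1 \<le> log 2 (real n)"
    using assms(1) by simp
  have "real (value_cost (n ^ 3)) \<le> 2 + log 2 (real (n ^ 3))"
    using assms(1) n by (simp add: value_cost_def floorlog_def log_nat_power)
  also have "\<dots> \<le> 5 * log 2 (real n)"
    using assms(1) n by (simp add: log_nat_power)
  finally show ?thesis
    using value_cost_mono[OF \<open>B \<le> n ^ 3\<close>] by simp
qed

section \<open>Running time in terms of vertices, edges and \<open>k\<close>\<close>

context helly_levels
begin

lemma total_cost_le: "real total_cost \<le> 2808 * (real (card E) * real n / real k)"
proof -
  define m where "m = card E"
  have n: "1 < n" "n \<le> 2 * m"
    using rad_less_card rad k vertices_le_edges by (auto simp: m_def)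
  \<comment> \<open>With \<open>n \<le> 2 * m\<close>, \<open>1 \<le> m\<close> and
    \<open>offset n = 2 * m\<close>, a search costs at most \<open>84 * m + 78 * m + 60 * m\<close>;
    a probe adds at most \<open>46 * m + 30 * m\<close>.\<close>
  have cost: "probe_cost \<le> 298 * m" "bfs_cost \<le> 222 * m"
    using n offset_eq_edges by (simp_all add: probe_cost_def bfs_cost_def m_def)
  have sum: "2 * (a + 82 * n + 70) + b + 29 * n + 60 \<le> 2 * a' + 808 * m"
    if "a \<le> a'" "b \<le> 222 * m" for a a' b
  proof -
    have "193 * n \<le> 386 * m" "200 \<le> 200 * m"
      using n by simp_all
    then show ?thesis
      using that by simp
  qed
  have "total_cost \<le> 2 * ((1 + n div k) * (298 * m)) + 808 * m"
    unfolding total_cost_def phase_cost_def using cost by (intro sum mult_left_mono) auto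
  also have "\<dots> \<le> 1404 * m * (1 + n div k)"
    by (simp add: algebra_simps)
  finally have "real total_cost \<le> 1404 * real m * real (1 + n div k)"
    by (metis of_nat_le_iff of_nat_mult of_nat_numeral)
  \<comment> \<open>As \<open>k \<le> n\<close>, the quotient \<open>n / k\<close> is at least 1 and
    absorbs the probe of the root.\<close>
  also have "\<dots> \<le> 1404 * real m * (2 * (real n / real k))"
  proof (intro mult_left_mono)
    have "real (n div k) \<le> real n / real k"
      by (rule of_nat_div_le_of_nat)
    moreover have "1 \<le> real n / real k"
      using k by simp
    ultimately show "real (1 + n div k) \<le> 2 * (real n / real k)"
      by simp
  qed simp
  finally show ?thesis
    by (simp add: m_def)
qed

end

theorem theorem3:
  fixes c :: real
  assumes "c > 0"
  shows "\<exists>P :: com. \<forall>\<kappa> :: nat \<Rightarrow> real. \<kappa> \<in> \<omega>(\<lambda>n. ln (real n)) \<longrightarrow>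
    (\<exists>(C :: real) (d :: nat). \<forall>(n :: nat) (m :: nat) (E :: nat set set) (L :: nat \<Rightarrow> nat list) (k :: nat).
       helly_graph {..<n} E \<and> m = card E \<and> adj_lists n E L \<and>
       0 < k \<and> rad {..<n} E > 3 * k \<and> 3 * real k \<ge> \<kappa> n \<longrightarrow>
       success_prob P (graph_input n m L k)
         (nat \<lfloor>C * (real m * real n / real k) * log 2 (real n) ^ d\<rfloor>)
         (\<lambda>s. diametral_pair {..<n} E (var s ''x'') (var s ''y''))
       \<ge> 1 - real n powr (- c))"
\<comment> \<open>The constant is \<open>2808 * 5\<close>, from \<open>total_cost_le\<close> and
  \<open>value_cost_le_log\<close>; the single logarithmic factor is the length of the values. The
  program flips no coin and succeeds with probability 1.\<close>
proof (rule exI[of _ diametral_pair_prog], intro allI impI, rule exI[of _ 14040], rule exI[of _ 1],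
    intro allI impI)
  fix \<kappa> :: "nat \<Rightarrow> real" and n m k :: nat and E :: "nat set set" and L :: "nat \<Rightarrow> nat list"
  assume asm: "helly_graph {..<n} E \<and> m = card E \<and> adj_lists n E L \<and>
    0 < k \<and> rad {..<n} E > 3 * k \<and> 3 * real k \<ge> \<kappa> n"
  \<comment> \<open>As \<open>offset n = 2 * m\<close>, this covers both \<open>2 * n\<close> and
    the positions in the neighbour array.\<close>
  define B where "B = 2 * n + 2 * m"
  interpret helly "{..<n}" E
    using asm by unfold_locales blast
  interpret listed_graph n E L
    using asm by unfold_locales blast
  have "k < n"
    using rad_less_card asm by simp
  interpret helly_levels n E L B k
    using asm \<open>k < n\<close> offset_eq_edges by unfold_locales (auto simp: B_def)
  let ?s = "graph_input n m L k"
  let ?Q = "\<lambda>s. diametral_pair {..<n} E (var s ''x'') (var s ''y'')"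
  let ?T = "14040 * (real m * real n / real k) * log 2 (real n) ^ 1"
  have B: "B \<le> 2 * n + n * n"
    using offset_eq_edges offset_le_square asm by (simp add: B_def)
  have "wp B diametral_pair_prog (\<lambda>_. ?Q) total_cost ?s"
    using graph_loaded_input by (intro wp_diametral_pair_prog) (auto simp: graph_input_def)
  then obtain u s' where u: "exec B diametral_pair_prog ?s u s'" "u \<le> total_cost" "?Q s'"
    unfolding wp_def by blast
  have "real (u * value_cost B) \<le> real total_cost * real (value_cost B)"
    using u(2) by (simp add: mult_right_mono)
  also have "\<dots> \<le> (2808 * (real m * real n / real k)) * (5 * log 2 (real n))"
    using total_cost_le value_cost_le_log[OF _ B] k \<open>k < n\<close> asm by (intro mult_mono) auto
  also have "\<dots> = ?T"
    by simp
  finally have "u * value_cost B \<le> nat \<lfloor>?T\<rfloor>"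
    by (rule le_nat_floor)
  moreover have "bounded_store B ?s"
    using \<open>k < n\<close> offset_eq_edges asm by (intro bounded_store_input) (auto simp: B_def)
  ultimately have "success_prob diametral_pair_prog ?s (nat \<lfloor>?T\<rfloor>) ?Q = 1"
    using exec_success_prob[where Q = ?Q, OF u(1) _ _ u(3)] by simp
  then show "success_prob diametral_pair_prog ?s (nat \<lfloor>?T\<rfloor>) ?Q \<ge> 1 - real n powr (- c)"
    by simp
qed

end
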